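(* For any $n\ge 1$ the cone $\mathcal{C}_n$ of all bounded ratios of products of minors of totally positive $n\times n$ matrices is a polyhedral cone in $V_n=\mathbb{R}^{N}$, $N=\binom{2n}{n}$; that is, there is a finite system $F$ of homogeneous linear inequalities in the exponents $(\alpha_I)$ whose solution set is exactly $\mathcal{C}_n$.
   Context: A real $n\times n$ matrix is totally positive if all its minors are positive. For $I,I'\subseteq\{1,\dots,n\}$ with $|I|=|I'|$, $\Delta_{I,I'}(X)$ is the minor of $X$ with row set $I$ and column set $I'$, and $\Delta_{\emptyset,\emptyset}(X)=1$. Plücker notation: for an $n$-element subset $K\subseteq\{1,\dots,2n\}$ put $[K]=\Delta_K(X):=\Delta_{I,I'}(X)$ with $I=K\cap\{1,\dots,n\}$ and $I'=\{1,\dots,n\}\setminus\{2n+1-k : k\in K,\ k\ge n+1\}$. (This is a maximal minor of the $2n\times n$ matrix obtained by stacking $X$ on top of $W_0=((-1)^{i+1}\delta_{j,n-i+1})_{i,j=1}^n$.) The map $K\mapsto(I,I')$ is a bijection between $n$-subsets of $\{1,\dots,2n\}$ and pairs $(I,I')$ with $|I|=|I'|$. A ratio is a Laurent monomial $R=\prod_K \Delta_K^{\alpha_K}$, with $\alpha_K\in\mathbb{Z}$, over the $N=\binom{2n}{n}$ Plücker coordinates, with $\sum_K\alpha_K=0$ (so that $R$ is a well-defined function on the Grassmannian; factors $\Delta_{\emptyset,\emptyset}=1$ may be used to balance the degrees). It is bounded if there is a constant $C$ with $R(X)\le C$ for all totally positive $n\times n$ matrices $X$. $V_n=\mathbb{R}^{N}$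 has a coordinate for each Plücker coordinate, and $R$ corresponds to the vector $(\alpha_K)_K\in V_n$. $\mathcal{C}_n\subseteq V_n$ is the cone formed by the bounded ratios, i.e. the convex cone (all finite nonnegative real combinations) generated by the vectors corresponding to bounded ratios. *)

theory Defs
  imports Complex_Main "Jordan_Normal_Form.Determinant" "Jordan_Normal_Form.DL_Submatrix"
begin

text \<open>Row and column sets, and the labels of Pluecker coordinates, are 1-based, i.e. subsets of
  \<open>{1..n}\<close> and \<open>{1..2*n}\<close>. The indices of the library's \<^const>\<open>submatrix\<close> start at 0, whence the
  shift in the following definition.\<close>

definition minor :: "real mat \<Rightarrow> nat set \<Rightarrow> nat set \<Rightarrow> real" where
  "minor X I J = det (submatrix X {i. Suc i \<in> I} {j. Suc j \<in> J})"

lemma minor_empty: "minor X {} {} = 1"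
  by (simp add: minor_def submatrix_def)

definition totally_positive :: "nat \<Rightarrow> real mat \<Rightarrow> bool" where
  "totally_positive n X \<longleftrightarrow> X \<in> carrier_mat n n \<and>
     (\<forall>I J. I \<subseteq> {1..n} \<and> J \<subseteq> {1..n} \<and> card I = card J \<longrightarrow> minor X I J > 0)"

definition pluecker_indices :: "nat \<Rightarrow> nat set set" where
  "pluecker_indices n = {K. K \<subseteq> {1..2*n} \<and> card K = n}"

lemma finite_pluecker_indices: "finite (pluecker_indices n)"
  by (rule finite_subset[of _ "Pow {1..2*n}"]) (auto simp: pluecker_indices_def)

lemma card_pluecker_indices: "card (pluecker_indices n) = (2 * n) choose n"
  using n_subsets[of "{1..2*n}" n] by (simp add: pluecker_indices_def)

definition pluecker_rows :: "nat \<Rightarrow> nat set \<Rightarrow> nat set" where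
  "pluecker_rows n K = K \<inter> {1..n}"

definition pluecker_cols :: "nat \<Rightarrow> nat set \<Rightarrow> nat set" where
  "pluecker_cols n K = {1..n} - {2*n + 1 - k | k. k \<in> K \<and> k \<ge> n + 1}"

lemma card_pluecker_rows_cols:
  assumes "K \<in> pluecker_indices n"
  shows "card (pluecker_rows n K) = card (pluecker_cols n K)"
proof -
  let ?H = "K \<inter> {n+1..2*n}"
  have K: "K \<subseteq> {1..2*n}" "card K = n" "finite K"
    using assms finite_subset by (auto simp: pluecker_indices_def)
  have im: "{2*n + 1 - k | k. k \<in> K \<and> k \<ge> n + 1} = (\<lambda>k. 2*n + 1 - k) ` ?H"
    using K(1) by fastforce
  have inj: "inj_on (\<lambda>k. 2*n + 1 - k) ?H"
    by (auto simp: inj_on_def)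
  have sub: "(\<lambda>k. 2*n + 1 - k) ` ?H \<subseteq> {1..n}"
    by auto
  have "K = pluecker_rows n K \<union> ?H"
    using K(1) by (auto simp: pluecker_rows_def)
  moreover have "pluecker_rows n K \<inter> ?H = {}"
    by (auto simp: pluecker_rows_def)
  ultimately have "n = card (pluecker_rows n K) + card ?H"
    using K by (metis card_Un_disjoint finite_Un)
  moreover have "card (pluecker_cols n K) = n - card ?H"
    unfolding pluecker_cols_def im using card_Diff_subset[OF _ sub] card_image[OF inj] K(3) by simp
  ultimately show ?thesis by simp
qed

definition pluecker :: "nat \<Rightarrow> nat set \<Rightarrow> real mat \<Rightarrow> real" where
  "pluecker n K X = minor X (pluecker_rows n K) (pluecker_cols n K)"

text \<open>The space \<open>V\<^sub>n\<close> of real vectors with one coordinate per Pluecker coordinate, realised as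
  functions on all sets of naturals which vanish off the index set.\<close>

definition V :: "nat \<Rightarrow> (nat set \<Rightarrow> real) set" where
  "V n = {v. \<forall>K. K \<notin> pluecker_indices n \<longrightarrow> v K = 0}"

definition ratio_exponents :: "nat \<Rightarrow> (nat set \<Rightarrow> int) set" where
  "ratio_exponents n =
     {\<alpha>. (\<forall>K. K \<notin> pluecker_indices n \<longrightarrow> \<alpha> K = 0) \<and> (\<Sum>K\<in>pluecker_indices n. \<alpha> K) = 0}"

definition ratio :: "nat \<Rightarrow> (nat set \<Rightarrow> int) \<Rightarrow> real mat \<Rightarrow> real" where
  "ratio n \<alpha> X = (\<Prod>K\<in>pluecker_indices n. pluecker n K X powi \<alpha> K)"

definition bounded_ratio :: "nat \<Rightarrow> (nat set \<Rightarrow> int) \<Rightarrow> bool" where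
  "bounded_ratio n \<alpha> \<longleftrightarrow>
     \<alpha> \<in> ratio_exponents n \<and> (\<exists>C. \<forall>X. totally_positive n X \<longrightarrow> ratio n \<alpha> X \<le> C)"

text \<open>The generated convex cone is spelled out as the set of finite nonnegative combinations, since
  the library's hull operators need a type of class \<open>real_vector\<close>.\<close>

definition cone_generated_by :: "(nat set \<Rightarrow> real) set \<Rightarrow> (nat set \<Rightarrow> real) set" where
  "cone_generated_by B =
     {(\<lambda>K. \<Sum>v\<in>S. c v * v K) | S c. finite S \<and> S \<subseteq> B \<and> (\<forall>v\<in>S. c v \<ge> 0)}"

definition bounded_ratio_cone :: "nat \<Rightarrow> (nat set \<Rightarrow> real) set" where
  "bounded_ratio_cone n = cone_generated_by {(\<lambda>K. real_of_int (\<alpha> K)) | \<alpha>. bounded_ratio n \<alpha>}"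

text \<open>A coefficient vector \<open>a \<in> F\<close> stands for the homogeneous linear inequality
  \<open>(\<Sum>K. a K * v K) \<ge> 0\<close>.\<close>

definition solution_set :: "nat \<Rightarrow> (nat set \<Rightarrow> real) set \<Rightarrow> (nat set \<Rightarrow> real) set" where
  "solution_set n F = {v \<in> V n. \<forall>a\<in>F. (\<Sum>K\<in>pluecker_indices n. a K * v K) \<ge> 0}"

definition polyhedral_cone :: "nat \<Rightarrow> (nat set \<Rightarrow> real) set \<Rightarrow> bool" where
  "polyhedral_cone n C \<longleftrightarrow> (\<exists>F. finite F \<and> F \<subseteq> V n \<and> C = solution_set n F)"

end

theory Submission
  imports Defs
begin

text \<open>
  Up to a signed cyclic shift of the labels, the Pluecker coordinates of \<open>X\<close> are the maximal minors
  of a \<open>2n \<times> n\<close> matrix and satisfy the three-term relations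
  \<open>p(ac) p(bd) = p(ab) p(cd) + p(ad) p(bc)\<close>. Solving these for \<open>p(ac)\<close> expresses every Pluecker
  coordinate through the initial minors by a formula without subtractions, and the initial minors of
  a totally positive matrix take arbitrary positive values. As \<open>ln (x + y)\<close> differs from
  \<open>max (ln x) (ln y)\<close> by at most \<open>ln 2\<close>, the logarithm of each Pluecker coordinate stays within
  bounded distance of a piecewise linear function \<open>h\<^sub>K(w)\<close> of the logarithms \<open>w\<close> of the initial
  minors, where \<open>w\<close> ranges over a full vector space. Hence the ratio with exponents \<open>\<alpha>\<close> is bounded iff
  \<open>(\<Sum>K. \<alpha> K * h\<^sub>K(w)) \<le> 0\<close> for all \<open>w\<close>. Finitely many cones with integral generators cover the
  space and have all \<open>h\<^sub>K\<close> linear on them, so it is enough to test the generators. This gives finitely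
  many inequalities with integer coefficients, and the cone which they define is generated by its
  integer points.
\<close>

section \<open>Piecewise linear functions and finitely generated cones\<close>

text \<open>Closing the generators under the cone operations lets facts about cone elements go by
  rule induction; \<open>cone_generated_by_eq\<close> recovers the explicit combinations.\<close>

inductive_set convex_cone :: "('i \<Rightarrow> real) set \<Rightarrow> ('i \<Rightarrow> real) set" for G where
  zero: "(\<lambda>_. 0) \<in> convex_cone G"
| gen: "g \<in> G \<Longrightarrow> g \<in> convex_cone G"
| add: "x \<in> convex_cone G \<Longrightarrow> y \<in> convex_cone G \<Longrightarrow> (\<lambda>i. x i + y i) \<in> convex_cone G"
| scale: "0 \<le> a \<Longrightarrow> x \<in> convex_cone G \<Longrightarrow> (\<lambda>i. a * x i) \<in> convex_cone G"

lemma convex_cone_subset: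
  assumes "G \<subseteq> convex_cone H"
  shows "convex_cone G \<subseteq> convex_cone H"
proof
  fix x assume "x \<in> convex_cone G"
  then show "x \<in> convex_cone H"
    by induction (use assms convex_cone.intros in auto)
qed

lemma convex_cone_sum:
  assumes "\<And>t. t \<in> T \<Longrightarrow> f t \<in> convex_cone G"
  shows "(\<lambda>i. \<Sum>t\<in>T. f t i) \<in> convex_cone G"
  using assms by (induction T rule: infinite_finite_induct) (auto intro: convex_cone.intros)

lemma cone_generated_by_eq: "cone_generated_by B = convex_cone B"
proof
  show "cone_generated_by B \<subseteq> convex_cone B"
  proof
    fix x assume "x \<in> cone_generated_by B"
    then obtain S c where "x = (\<lambda>K. \<Sum>v\<in>S. c v * v K)" "S \<subseteq> B" "\<forall>v\<in>S. c v \<ge> 0"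
      unfolding cone_generated_by_def by auto
    then show "x \<in> convex_cone B" by (auto intro!: convex_cone_sum intro: convex_cone.scale convex_cone.gen)
  qed
  show "convex_cone B \<subseteq> cone_generated_by B"
  proof
    fix x assume "x \<in> convex_cone B"
    then show "x \<in> cone_generated_by B"
    proof induction
      case zero
      show ?case unfolding cone_generated_by_def
        by (intro CollectI exI[of _ "{}"]) auto
    next
      case (gen g)
      then show ?case unfolding cone_generated_by_def
        by (intro CollectI exI[of _ "{g}"] exI[of _ "\<lambda>_. 1"]) auto
    next
      case (add x y)
      obtain S c where x: "x = (\<lambda>K. \<Sum>v\<in>S. c v * v K)" "finite S" "S \<subseteq> B" "\<forall>v\<in>S. c v \<ge> 0"
        using add.IH(1) unfolding cone_generated_by_def by auto
      obtain T d where y: "y = (\<lambda>K. \<Sum>v\<in>T. d v * v K)" "finite T" "T \<subseteq> B" "\<forall>v\<in>T. d v \<ge> 0"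
        using add.IH(2) unfolding cone_generated_by_def by auto
      define e where "e v = (if v \<in> S then c v else 0) + (if v \<in> T then d v else 0)" for v
      have "(\<Sum>v\<in>S. c v * v K) = (\<Sum>v\<in>S \<union> T. (if v \<in> S then c v else 0) * v K)" for K
        using x(2) y(2) by (intro sum.mono_neutral_cong_left) auto
      moreover have "(\<Sum>v\<in>T. d v * v K) = (\<Sum>v\<in>S \<union> T. (if v \<in> T then d v else 0) * v K)" for K
        using x(2) y(2) by (intro sum.mono_neutral_cong_left) auto
      ultimately have "(\<lambda>K. x K + y K) = (\<lambda>K. \<Sum>v\<in>S \<union> T. e v * v K)"
        unfolding x(1) y(1) e_def by (simp add: distrib_right sum.distrib)
      then show ?case unfolding cone_generated_by_def
        using x y by (intro CollectI exI[of _ "S \<union> T"] exI[of _ e]) (auto simp: e_def)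
    next
      case (scale a x)
      obtain S c where "x = (\<lambda>K. \<Sum>v\<in>S. c v * v K)" "finite S" "S \<subseteq> B" "\<forall>v\<in>S. c v \<ge> 0"
        using scale.IH unfolding cone_generated_by_def by auto
      then show ?case unfolding cone_generated_by_def using scale.hyps(1)
        by (intro CollectI exI[of _ S] exI[of _ "\<lambda>v. a * c v"])
          (auto simp: sum_distrib_left mult.assoc)
    qed
  qed
qed

text \<open>Besides linearity on the cone, \<open>h\<close> is required to be integral on the generators; this keeps
  all generators below integral.\<close>

definition linear_on_cone :: "(('i \<Rightarrow> real) \<Rightarrow> real) \<Rightarrow> ('i \<Rightarrow> real) set \<Rightarrow> bool" where
  "linear_on_cone h G \<longleftrightarrow>
     (\<forall>x\<in>convex_cone G. \<forall>y\<in>convex_cone G. h (\<lambda>i. x i + y i) = h x + h y) \<and>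
     (\<forall>a\<ge>0. \<forall>x\<in>convex_cone G. h (\<lambda>i. a * x i) = a * h x) \<and>
     (\<forall>g\<in>G. h g \<in> \<int>)"

lemma linear_on_cone_scale:
  assumes "linear_on_cone h G" "a \<ge> 0" "x \<in> convex_cone G"
  shows "h (\<lambda>i. a * x i) = a * h x"
  using assms unfolding linear_on_cone_def by blast

lemma linear_on_cone_0:
  assumes "linear_on_cone h G"
  shows "h (\<lambda>_. 0) = 0"
  using linear_on_cone_scale[OF assms order_refl convex_cone.zero] by simp

lemma linear_on_cone_add_scale:
  assumes "linear_on_cone h G" "x \<in> convex_cone G" "y \<in> convex_cone G" "a \<ge> 0" "b \<ge> 0"
  shows "h (\<lambda>i. a * x i + b * y i) = a * h x + b * h y"
  using assms convex_cone.scale[OF assms(4,2)] convex_cone.scale[OF assms(5,3)]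
  unfolding linear_on_cone_def by simp

lemma linear_on_cone_plus:
  "linear_on_cone h G \<Longrightarrow> linear_on_cone k G \<Longrightarrow> linear_on_cone (\<lambda>x. h x + k x) G"
  unfolding linear_on_cone_def by (auto simp: algebra_simps)

lemma linear_on_cone_uminus:
  "linear_on_cone h G \<Longrightarrow> linear_on_cone (\<lambda>x. - h x) G"
  unfolding linear_on_cone_def by auto

lemma linear_on_cone_diff:
  "linear_on_cone h G \<Longrightarrow> linear_on_cone k G \<Longrightarrow> linear_on_cone (\<lambda>x. h x - k x) G"
  using linear_on_cone_plus[OF _ linear_on_cone_uminus, of h G k] by simp

lemma linear_on_cone_sum:
  assumes "\<And>t. t \<in> T \<Longrightarrow> linear_on_cone (h t) G" "\<And>t. t \<in> T \<Longrightarrow> a t \<in> \<int>"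
  shows "linear_on_cone (\<lambda>x. \<Sum>t\<in>T. a t * h t x) G"
  unfolding linear_on_cone_def
proof (intro conjI ballI allI impI)
  fix x y assume "x \<in> convex_cone G" "y \<in> convex_cone G"
  then have "h t (\<lambda>i. x i + y i) = h t x + h t y" if "t \<in> T" for t
    using assms(1)[OF that] unfolding linear_on_cone_def by blast
  then show "(\<Sum>t\<in>T. a t * h t (\<lambda>i. x i + y i)) = (\<Sum>t\<in>T. a t * h t x) + (\<Sum>t\<in>T. a t * h t y)"
    by (simp add: distrib_left sum.distrib)
next
  fix b :: real and x assume "b \<ge> 0" "x \<in> convex_cone G"
  then have "h t (\<lambda>i. b * x i) = b * h t x" if "t \<in> T" for t
    using assms(1)[OF that] by (rule linear_on_cone_scale[rotated])
  then show "(\<Sum>t\<in>T. a t * h t (\<lambda>i. b * x i)) = b * (\<Sum>t\<in>T. a t * h t x)"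
    by (simp add: sum_distrib_left mult.left_commute)
next
  fix g assume "g \<in> G"
  then show "(\<Sum>t\<in>T. a t * h t g) \<in> \<int>"
    using assms by (intro Ints_sum Ints_mult) (auto simp: linear_on_cone_def)
qed

lemma linear_on_cone_cong:
  assumes "linear_on_cone h G" "\<And>x. x \<in> convex_cone G \<Longrightarrow> k x = h x"
  shows "linear_on_cone k G"
  using assms unfolding linear_on_cone_def by (simp add: convex_cone.intros)

lemma linear_on_cone_nonneg:
  assumes "linear_on_cone h G" "\<And>g. g \<in> G \<Longrightarrow> h g \<ge> 0" "x \<in> convex_cone G"
  shows "h x \<ge> 0"
  using assms(3)
proof induction
  case zero
  show ?case using linear_on_cone_0[OF assms(1)] by simp
next
  case (gen g)
  then show ?case by (rule assms(2))
next
  case (add x y)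
  then show ?case using linear_on_cone_add_scale[OF assms(1) add.hyps, of 1 1] by simp
next
  case (scale a x)
  then show ?case using linear_on_cone_add_scale[OF assms(1) scale.hyps(2,2), of a 0] by simp
qed

text \<open>Generators of the part of the cone in the half space \<open>D \<ge> 0\<close> (Motzkin's double description
  step): each pair of generators on opposite sides contributes a positive
  combination with \<open>D = 0\<close>.\<close>

definition half_generators :: "(('i \<Rightarrow> real) \<Rightarrow> real) \<Rightarrow> ('i \<Rightarrow> real) set \<Rightarrow> ('i \<Rightarrow> real) set" where
  "half_generators D G = {g \<in> G. D g \<ge> 0} \<union>
     (\<lambda>(p, q) i. D p * q i + - D q * p i) ` ({p \<in> G. D p > 0} \<times> {q \<in> G. D q < 0})"

lemma finite_half_generators: "finite G \<Longrightarrow> finite (half_generators D G)"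
  unfolding half_generators_def by auto

lemma half_generators_subset: "half_generators D G \<subseteq> convex_cone G"
proof -
  have "(\<lambda>i. D p * q i + - D q * p i) \<in> convex_cone G"
    if "p \<in> G" "D p > 0" "q \<in> G" "D q < 0" for p q
    using that by (intro convex_cone.add convex_cone.scale convex_cone.gen) auto
  then show ?thesis unfolding half_generators_def by (auto intro: convex_cone.gen)
qed

lemma convex_cone_half_subset: "convex_cone (half_generators D G) \<subseteq> convex_cone G"
  by (rule convex_cone_subset[OF half_generators_subset])

text \<open>A new generator is \<open>D p * q - D q * p\<close> with \<open>p\<close> and
  \<open>q\<close> among the old ones. Its coefficients are values of \<open>D\<close>, hence
  integers, so integrality of \<open>h\<close> survives the cut.\<close>

lemma linear_on_half:
  assumes D: "linear_on_cone D G" and h: "linear_on_cone h G"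
  shows "linear_on_cone h (half_generators D G)"
proof -
  have "h g \<in> \<int>" if "g \<in> half_generators D G" for g
  proof (cases "g \<in> G")
    case True
    then show ?thesis using h by (auto simp: linear_on_cone_def)
  next
    case False
    then obtain p q where pq: "g = (\<lambda>i. D p * q i + - D q * p i)" "p \<in> G" "D p > 0" "q \<in> G" "D q < 0"
      using \<open>g \<in> half_generators D G\<close> unfolding half_generators_def by auto
    have "h g = D p * h q + - D q * h p" unfolding pq(1)
      using pq by (intro linear_on_cone_add_scale[OF h]) (auto intro: convex_cone.gen)
    moreover have "D p \<in> \<int>" "D q \<in> \<int>" "h p \<in> \<int>" "h q \<in> \<int>"
      using D h pq by (auto simp: linear_on_cone_def)
    ultimately show ?thesis by simp
  qed
  then show ?thesis using h convex_cone_half_subset[of D G]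
    unfolding linear_on_cone_def by (meson subsetD)
qed

lemma half_nonneg:
  assumes D: "linear_on_cone D G" and x: "x \<in> convex_cone (half_generators D G)"
  shows "D x \<ge> 0"
proof (rule linear_on_cone_nonneg[OF linear_on_half[OF D D] _ x])
  fix g assume "g \<in> half_generators D G"
  moreover have "D (\<lambda>i. D p * q i + - D q * p i) = 0"
    if "p \<in> G" "D p > 0" "q \<in> G" "D q < 0" for p q
    using that linear_on_cone_add_scale[OF D, of q p "D p" "- D q"] by (auto intro: convex_cone.gen)
  ultimately show "D g \<ge> 0" unfolding half_generators_def by auto
qed

text \<open>The weights make \<open>D\<close> vanish on the combination, so it lies on the cutting
  hyperplane. Since \<open>D\<close> is linear on the cone, the expression is additive and
  homogeneous in \<open>x\<close> and in \<open>y\<close> separately, which reduces the claim to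
  pairs of generators.\<close>

lemma half_mix:
  fixes G :: "('i \<Rightarrow> real) set"
  assumes D: "linear_on_cone D G"
    and x: "x \<in> convex_cone (half_generators D G)"
    and y: "y \<in> convex_cone (half_generators (\<lambda>x. - D x) G)"
  shows "(\<lambda>i. D x * y i + - D y * x i) \<in> convex_cone (half_generators D G)"
proof -
  let ?P = "half_generators D G" and ?N = "half_generators (\<lambda>x. - D x) G"
  note Dm = linear_on_cone_uminus[OF D]
  have DP: "linear_on_cone D ?P" by (rule linear_on_half[OF D D])
  have DN: "linear_on_cone D ?N" by (rule linear_on_half[OF Dm D])
  have gg: "(\<lambda>i. D p * q i + - D q * p i) \<in> convex_cone ?P" if p: "p \<in> ?P" and q: "q \<in> ?N" for p q
  proof -
    have mixed: "D r = 0" if "r \<in> ?N" "\<not> (r \<in> G)" for r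
    proof -
      obtain u v where "r = (\<lambda>i. - D u * v i + - (- D v) * u i)" "u \<in> G" "D u < 0" "v \<in> G" "D v > 0"
        using \<open>r \<in> ?N\<close> \<open>\<not> (r \<in> G)\<close> unfolding half_generators_def by auto
      then show ?thesis
        using linear_on_cone_add_scale[OF D, of v u "- D u" "D v"] by (auto intro: convex_cone.gen)
    qed
    \<comment> \<open>A mixed generator comes out the same when the two sides swap roles, so both
      halves share their generators on the hyperplane.\<close>
    have mixed2: "r \<in> convex_cone ?P" if "r \<in> ?N" "D r = 0" for r
    proof (cases "r \<in> G")
      case True
      then show ?thesis using that by (auto simp: half_generators_def intro: convex_cone.gen)
    next
      case False
      then obtain u v where "r = (\<lambda>i. - D u * v i + - (- D v) * u i)" "u \<in> G" "D u < 0" "v \<in> G" "D v > 0"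
        using \<open>r \<in> ?N\<close> unfolding half_generators_def by auto
      then have "r \<in> ?P" unfolding half_generators_def
        by (intro UnI2 image_eqI[of _ _ "(v, u)"]) auto
      then show ?thesis by (rule convex_cone.gen)
    qed
    have Dp: "D p \<ge> 0" using half_nonneg[OF D convex_cone.gen[OF p]] .
    have Dq: "D q \<le> 0" using half_nonneg[OF Dm convex_cone.gen[OF q]] by simp
    show ?thesis
    proof (cases "D p > 0 \<and> D q < 0")
      case True
      \<comment> \<open>Mixed generators have \<open>D = 0\<close>, so generators strictly off the
        hyperplane are old ones, and their combination is a generator of the half.\<close>
      have "p \<in> G"
      proof (rule ccontr)
        assume "p \<notin> G"
        then obtain u v where "p = (\<lambda>i. D u * v i + - D v * u i)" "u \<in> G" "D u > 0" "v \<in> G" "D v < 0"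
          using p unfolding half_generators_def by auto
        then have "D p = 0"
          using linear_on_cone_add_scale[OF D, of v u "D u" "- D v"] by (auto intro: convex_cone.gen)
        with True show False by simp
      qed
      moreover have "q \<in> G" using mixed[OF q] True by auto
      ultimately have "(\<lambda>i. D p * q i + - D q * p i) \<in> ?P" using True unfolding half_generators_def
        by (intro UnI2 image_eqI[of _ _ "(p, q)"]) auto
      then show ?thesis by (rule convex_cone.gen)
    next
      case False
      then consider "D p = 0" | "D q = 0" using Dp Dq by linarith
      then show ?thesis
      proof cases
        case 1
        then have "(\<lambda>i. D p * q i + - D q * p i) = (\<lambda>i. - D q * p i)" by auto
        then show ?thesis using convex_cone.scale[OF _ convex_cone.gen[OF p], of "- D q"] Dq by simp
      next
        case 2
        then have "(\<lambda>i. D p * q i + - D q * p i) = (\<lambda>i. D p * q i)" by auto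
        then show ?thesis using convex_cone.scale[OF Dp mixed2[OF q 2]] by simp
      qed
    qed
  qed
  have gy: "(\<lambda>i. D p * y i + - D y * p i) \<in> convex_cone ?P" if p: "p \<in> ?P" for p
    using y
  proof induction
    case zero
    then show ?case using linear_on_cone_0[OF D] by (simp add: convex_cone.zero)
  next
    case (gen g)
    then show ?case by (rule gg[OF p])
  next
    case (add x y)
    have "D (\<lambda>i. x i + y i) = D x + D y" using DN add.hyps by (simp add: linear_on_cone_def)
    then show ?case using convex_cone.add[OF add.IH] by (simp add: algebra_simps)
  next
    case (scale a x)
    have "D (\<lambda>i. a * x i) = a * D x" using DN scale.hyps by (simp add: linear_on_cone_def)
    then show ?case using convex_cone.scale[OF scale.hyps(1) scale.IH] by (simp add: algebra_simps)
  qed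
  show ?thesis using x
  proof induction
    case zero
    then show ?case using linear_on_cone_0[OF D] by (simp add: convex_cone.zero)
  next
    case (gen g)
    then show ?case by (rule gy)
  next
    case (add x z)
    have "D (\<lambda>i. x i + z i) = D x + D z" using DP add.hyps by (simp add: linear_on_cone_def)
    then show ?case using convex_cone.add[OF add.IH] by (simp add: algebra_simps)
  next
    case (scale a x)
    have "D (\<lambda>i. a * x i) = a * D x" using DP scale.hyps by (simp add: linear_on_cone_def)
    then show ?case using convex_cone.scale[OF scale.hyps(1) scale.IH] by (simp add: algebra_simps)
  qed
qed

text \<open>If \<open>D x > 0\<close>, the sum is a nonnegative combination of \<open>x\<close> and
  the point of \<open>half_mix\<close> on the hyperplane. If \<open>D x = 0\<close>, the sign
  conditions force \<open>D y = 0\<close>, and \<open>y\<close> itself lies in the half.\<close>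

lemma half_add:
  assumes D: "linear_on_cone D G"
    and x: "x \<in> convex_cone (half_generators D G)"
    and y: "y \<in> convex_cone (half_generators (\<lambda>x. - D x) G)"
    and pos: "D x + D y \<ge> 0"
  shows "(\<lambda>i. x i + y i) \<in> convex_cone (half_generators D G)"
proof (cases "D x = 0")
  case True
  have "D y \<le> 0" using half_nonneg[OF linear_on_cone_uminus[OF D] y] by simp
  with True pos have "D y = 0" by simp
  have "y \<in> convex_cone (half_generators D G)"
    using y \<open>D y = 0\<close>
  proof induction
    case zero
    show ?case by (rule convex_cone.zero)
  next
    case (gen g)
    show ?case
    proof (cases "g \<in> G")
      case True
      then show ?thesis using gen by (auto simp: half_generators_def intro: convex_cone.gen)
    next
      case False
      then obtain u v where "g = (\<lambda>i. - D u * v i + - (- D v) * u i)" "u \<in> G" "D u < 0" "v \<in> G" "D v > 0"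
        using gen(1) unfolding half_generators_def by auto
      then have "g \<in> half_generators D G" unfolding half_generators_def
        by (intro UnI2 image_eqI[of _ _ "(v, u)"]) auto
      then show ?thesis by (rule convex_cone.gen)
    qed
  next
    case (add x y)
    note L = linear_on_half[OF linear_on_cone_uminus[OF D] D]
    have "D (\<lambda>i. x i + y i) = D x + D y" using L add.hyps by (simp add: linear_on_cone_def)
    \<comment> \<open>Neither summand has positive \<open>D\<close>, so if \<open>D\<close> vanishes
      on the sum it vanishes on both, and the induction hypotheses apply.\<close>
    moreover have "D x \<le> 0" "D y \<le> 0"
      using half_nonneg[OF linear_on_cone_uminus[OF D] add.hyps(1)]
        half_nonneg[OF linear_on_cone_uminus[OF D] add.hyps(2)] by auto
    ultimately show ?case using add by (auto intro: convex_cone.add)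
  next
    case (scale a x)
    note L = linear_on_half[OF linear_on_cone_uminus[OF D] D]
    have e: "D (\<lambda>i. a * x i) = a * D x" using L scale.hyps by (simp add: linear_on_cone_def)
    show ?case
    proof (cases "a = 0")
      case True
      then show ?thesis by (simp add: convex_cone.zero)
    next
      case False
      then show ?thesis using e scale by (auto intro: convex_cone.scale)
    qed
  qed
  then show ?thesis using x by (auto intro: convex_cone.add)
next
  case False
  then have Dx: "D x > 0" using half_nonneg[OF D x] by simp
  have "(\<lambda>i. ((D x + D y) / D x) * x i + (1 / D x) * (D x * y i + - D y * x i))
      \<in> convex_cone (half_generators D G)"
    using Dx pos by (intro convex_cone.add convex_cone.scale half_mix[OF D x y] x) auto
  moreover have "(\<lambda>i. ((D x + D y) / D x) * x i + (1 / D x) * (D x * y i + - D y * x i)) = (\<lambda>i. x i + y i)"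
    using Dx by (auto simp: field_simps fun_eq_iff)
  ultimately show ?thesis by simp
qed

text \<open>The two halves cover the cone. Both inclusions are carried through one induction because
  a sum can join points from opposite sides, which \<open>half_add\<close> settles.\<close>

lemma convex_cone_half:
  assumes D: "linear_on_cone D G" and x: "x \<in> convex_cone G"
  shows "(D x \<ge> 0 \<longrightarrow> x \<in> convex_cone (half_generators D G)) \<and>
    (D x \<le> 0 \<longrightarrow> x \<in> convex_cone (half_generators (\<lambda>x. - D x) G))"
  using x
proof induction
  case zero
  show ?case by (auto intro: convex_cone.zero)
next
  case (gen g)
  then show ?case by (auto simp: half_generators_def intro: convex_cone.gen)
next
  case (add x y)
  note Dm = linear_on_cone_uminus[OF D]
  have e: "D (\<lambda>i. x i + y i) = D x + D y" using D add.hyps by (simp add: linear_on_cone_def)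
  consider "D x \<ge> 0" "D y \<ge> 0" | "D x \<le> 0" "D y \<le> 0" | "D x \<ge> 0" "D y \<le> 0" | "D x \<le> 0" "D y \<ge> 0"
    by linarith
  then show ?case
  proof cases
    case 1
    then have "x \<in> convex_cone (half_generators D G)" "y \<in> convex_cone (half_generators D G)" using add by auto
    moreover have "D x = 0 \<and> D y = 0" if "D x + D y \<le> 0" using that 1 by linarith
    ultimately show ?thesis using add.IH unfolding e by (auto intro!: convex_cone.add)
  next
    case 2
    then have "x \<in> convex_cone (half_generators (\<lambda>x. - D x) G)" "y \<in> convex_cone (half_generators (\<lambda>x. - D x) G)" using add by auto
    moreover have "D x = 0 \<and> D y = 0" if "D x + D y \<ge> 0" using that 2 by linarith
    ultimately show ?thesis using add.IH unfolding e by (auto intro!: convex_cone.add)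
  next
    case 3
    have x: "x \<in> convex_cone (half_generators D G)" and y: "y \<in> convex_cone (half_generators (\<lambda>x. - D x) G)"
      using add 3 by auto
    have "(\<lambda>i. x i + y i) \<in> convex_cone (half_generators (\<lambda>x. - D x) G)" if "D x + D y \<le> 0"
      using half_add[OF Dm y, of x] x that by (simp add: add.commute)
    then show ?thesis unfolding e using half_add[OF D x y] by blast
  next
    case 4
    have y: "y \<in> convex_cone (half_generators D G)" and x: "x \<in> convex_cone (half_generators (\<lambda>x. - D x) G)"
      using add 4 by auto
    have "(\<lambda>i. x i + y i) \<in> convex_cone (half_generators D G)" if "D x + D y \<ge> 0"
      using half_add[OF D y x] that by (simp add: add.commute)
    moreover have "(\<lambda>i. x i + y i) \<in> convex_cone (half_generators (\<lambda>x. - D x) G)" if "D x + D y \<le> 0"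
      using half_add[OF Dm x, of y] y that by simp
    ultimately show ?thesis unfolding e by blast
  qed
next
  case (scale a x)
  have e: "D (\<lambda>i. a * x i) = a * D x" using D scale.hyps by (simp add: linear_on_cone_def)
  show ?case
  proof (cases "a = 0")
    case True
    then show ?thesis by (auto intro: convex_cone.zero)
  next
    case False
    with scale have "a > 0" by simp
    then show ?thesis unfolding e using scale
      by (auto intro!: convex_cone.scale simp: zero_le_mult_iff mult_le_0_iff)
  qed
qed

section \<open>Piecewise linear functions and fans on which they are linear\<close>

text \<open>Under logarithms products, quotients and sums become sums, differences and, up to
  bounded error, maxima. These functions are thus the tropicalisations of subtraction-free
  expressions.\<close>

inductive_set pl_functions :: "(('i \<Rightarrow> real) \<Rightarrow> real) set" where
  coord: "(\<lambda>x. x i) \<in> pl_functions"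
| plus: "h \<in> pl_functions \<Longrightarrow> k \<in> pl_functions \<Longrightarrow> (\<lambda>x. h x + k x) \<in> pl_functions"
| minus: "h \<in> pl_functions \<Longrightarrow> k \<in> pl_functions \<Longrightarrow> (\<lambda>x. h x - k x) \<in> pl_functions"
| max: "h \<in> pl_functions \<Longrightarrow> k \<in> pl_functions \<Longrightarrow> (\<lambda>x. max (h x) (k x)) \<in> pl_functions"

lemma pl_functions_scale:
  assumes "h \<in> pl_functions" "a \<ge> 0"
  shows "h (\<lambda>i. a * x i) = a * h x"
  using assms(1) by induction (use assms(2) in \<open>auto simp: algebra_simps max_mult_distrib_left\<close>)

text \<open>Only the covering property matters: the cones may overlap in their interiors.\<close>

definition fan :: "('i \<Rightarrow> real) set \<Rightarrow> ('i \<Rightarrow> real) set set \<Rightarrow> bool" where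
  "fan U \<G> \<longleftrightarrow> finite \<G> \<and> (\<forall>G\<in>\<G>. finite G \<and> (\<forall>i. linear_on_cone (\<lambda>x. x i) G)) \<and>
     (\<Union>G\<in>\<G>. convex_cone G) = U"

text \<open>Refinement is described by what it must preserve: linearity gained for one function has
  to survive the subdivisions made for later ones.\<close>

definition fan_refines :: "('i \<Rightarrow> real) set set \<Rightarrow> ('i \<Rightarrow> real) set set \<Rightarrow> bool" where
  "fan_refines \<G> \<F> \<longleftrightarrow>
     (\<forall>h. (\<forall>G\<in>\<G>. linear_on_cone h G) \<longrightarrow> (\<forall>F\<in>\<F>. linear_on_cone h F))"

lemma fan_refinesD:
  "fan_refines \<G> \<F> \<Longrightarrow> \<forall>G\<in>\<G>. linear_on_cone h G \<Longrightarrow> \<forall>F\<in>\<F>. linear_on_cone h F"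
  by (simp add: fan_refines_def)

lemma fan_refines_trans: "fan_refines \<G> \<F> \<Longrightarrow> fan_refines \<F> \<H> \<Longrightarrow> fan_refines \<G> \<H>"
  by (simp add: fan_refines_def)

text \<open>Each cone is cut along \<open>h = k\<close>; on either side the maximum is one of the
  two functions, and both are linear on the whole cone.\<close>

lemma fan_refine_max:
  assumes "fan U \<G>" and h: "\<And>G. G \<in> \<G> \<Longrightarrow> linear_on_cone h G"
    and k: "\<And>G. G \<in> \<G> \<Longrightarrow> linear_on_cone k G"
  shows "\<exists>\<F>. fan U \<F> \<and> (\<forall>G\<in>\<F>. linear_on_cone (\<lambda>x. max (h x) (k x)) G) \<and>
    fan_refines \<G> \<F>"
proof -
  let ?D = "\<lambda>x. h x - k x"
  let ?P = "half_generators ?D" and ?N = "half_generators (\<lambda>x. - ?D x)"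
  let ?F = "?P ` \<G> \<union> ?N ` \<G>"
  have D: "linear_on_cone ?D G" if "G \<in> \<G>" for G by (intro linear_on_cone_diff h k that)
  have Dm: "linear_on_cone (\<lambda>x. - ?D x) G" if "G \<in> \<G>" for G by (rule linear_on_cone_uminus[OF D[OF that]])
  have lin: "linear_on_cone f (?P G)" "linear_on_cone f (?N G)" if "linear_on_cone f G" "G \<in> \<G>" for f G
    using linear_on_half[OF D[OF that(2)] that(1)] linear_on_half[OF Dm[OF that(2)] that(1)] .
  have "convex_cone G = convex_cone (?P G) \<union> convex_cone (?N G)" if "G \<in> \<G>" for G
  proof
    show "convex_cone G \<subseteq> convex_cone (?P G) \<union> convex_cone (?N G)"
    proof
      fix x assume "x \<in> convex_cone G"
      then show "x \<in> convex_cone (?P G) \<union> convex_cone (?N G)"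
        using convex_cone_half[OF D[OF that], of x] by (cases "?D x \<ge> 0") auto
    qed
  qed (use convex_cone_half_subset in blast)
  then have "(\<Union>G\<in>?F. convex_cone G) = U"
    using \<open>fan U \<G>\<close> unfolding fan_def by auto
  then have "fan U ?F" using \<open>fan U \<G>\<close> lin unfolding fan_def by (auto intro!: finite_half_generators)
  moreover have "linear_on_cone (\<lambda>x. max (h x) (k x)) (?P G)" if "G \<in> \<G>" for G
    by (rule linear_on_cone_cong[OF lin(1)[OF h[OF that] that]]) (use half_nonneg[OF D[OF that]] in force)
  moreover have "linear_on_cone (\<lambda>x. max (h x) (k x)) (?N G)" if "G \<in> \<G>" for G
    by (rule linear_on_cone_cong[OF lin(2)[OF k[OF that] that]]) (use half_nonneg[OF Dm[OF that]] in force)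
  moreover have "fan_refines \<G> ?F" using lin by (auto simp: fan_refines_def)
  ultimately show ?thesis by (intro exI[of _ ?F]) auto
qed

lemma fan_refine:
  assumes "h \<in> pl_functions" "fan U \<G>"
  shows "\<exists>\<F>. fan U \<F> \<and> (\<forall>G\<in>\<F>. linear_on_cone h G) \<and> fan_refines \<G> \<F>"
  using assms
proof (induction arbitrary: \<G>)
  case (coord i)
  then have "\<forall>G\<in>\<G>. linear_on_cone (\<lambda>x. x i) G" by (simp add: fan_def)
  with coord show ?case by (intro exI[of _ \<G>]) (simp add: fan_refines_def)
next
  case (plus h k)
  from plus.IH(1)[OF plus.prems] obtain \<F> where
    F: "fan U \<F>" "\<forall>G\<in>\<F>. linear_on_cone h G" "fan_refines \<G> \<F>" by auto
  from plus.IH(2)[OF F(1)] obtain \<F>' where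
    F': "fan U \<F>'" "\<forall>G\<in>\<F>'. linear_on_cone k G" "fan_refines \<F> \<F>'" by auto
  have "\<forall>G\<in>\<F>'. linear_on_cone (\<lambda>x. h x + k x) G"
    using fan_refinesD[OF F'(3) F(2)] F'(2) by (simp add: linear_on_cone_plus)
  then show ?case using F'(1) fan_refines_trans[OF F(3) F'(3)] by (intro exI[of _ \<F>'] conjI)
next
  case (minus h k)
  from minus.IH(1)[OF minus.prems] obtain \<F> where
    F: "fan U \<F>" "\<forall>G\<in>\<F>. linear_on_cone h G" "fan_refines \<G> \<F>" by auto
  from minus.IH(2)[OF F(1)] obtain \<F>' where
    F': "fan U \<F>'" "\<forall>G\<in>\<F>'. linear_on_cone k G" "fan_refines \<F> \<F>'" by auto
  have "\<forall>G\<in>\<F>'. linear_on_cone (\<lambda>x. h x - k x) G"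
    using fan_refinesD[OF F'(3) F(2)] F'(2) by (simp add: linear_on_cone_diff)
  then show ?case using F'(1) fan_refines_trans[OF F(3) F'(3)] by (intro exI[of _ \<F>'] conjI)
next
  case (max h k)
  from max.IH(1)[OF max.prems] obtain \<F> where
    F: "fan U \<F>" "\<forall>G\<in>\<F>. linear_on_cone h G" "fan_refines \<G> \<F>" by auto
  from max.IH(2)[OF F(1)] obtain \<F>' where
    F': "fan U \<F>'" "\<forall>G\<in>\<F>'. linear_on_cone k G" "fan_refines \<F> \<F>'" by auto
  obtain \<F>'' where "fan U \<F>''" "\<forall>G\<in>\<F>''. linear_on_cone (\<lambda>x. max (h x) (k x)) G" "fan_refines \<F>' \<F>''"
    using fan_refine_max[OF F'(1), of h k] fan_refinesD[OF F'(3) F(2)] F'(2) by auto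
  then show ?case using fan_refines_trans[OF fan_refines_trans[OF F(3) F'(3)]]
    by (intro exI[of _ \<F>''] conjI)
qed

lemma fan_refine_finite:
  assumes "finite T" "\<And>t. t \<in> T \<Longrightarrow> h t \<in> pl_functions" "fan U \<G>"
  shows "\<exists>\<F>. fan U \<F> \<and> (\<forall>t\<in>T. \<forall>G\<in>\<F>. linear_on_cone (h t) G)"
  using assms
proof (induction T)
  case empty
  then show ?case by auto
next
  case (insert t T)
  then obtain \<F> where F: "fan U \<F>" "\<forall>t\<in>T. \<forall>G\<in>\<F>. linear_on_cone (h t) G" by auto
  from fan_refine[OF insert.prems(1) F(1), of t] obtain \<F>' where
    F': "fan U \<F>'" "\<forall>G\<in>\<F>'. linear_on_cone (h t) G" "fan_refines \<F> \<F>'" by auto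
  have "\<forall>G\<in>\<F>'. linear_on_cone (h s) G" if "s \<in> T" for s
    using fan_refinesD[OF F'(3)] F(2) that by simp
  with F' show ?case by (intro exI[of _ \<F>']) simp
qed

section \<open>Coordinate spaces and cones cut out by integral inequalities\<close>

definition supported_on :: "'i set \<Rightarrow> ('i \<Rightarrow> real) set" where
  "supported_on I = {v. \<forall>i. i \<notin> I \<longrightarrow> v i = 0}"

definition unit_vectors :: "'i set \<Rightarrow> ('i \<Rightarrow> real) set" where
  "unit_vectors I = (\<lambda>(s, i) j. if j = i then s else 0) ` ({1, - 1} \<times> I)"

lemma convex_cone_unit_vectors:
  assumes "finite I"
  shows "convex_cone (unit_vectors I) = supported_on I"
proof
  show "convex_cone (unit_vectors I) \<subseteq> supported_on I"
  proof
    fix x assume "x \<in> convex_cone (unit_vectors I)"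
    then show "x \<in> supported_on I"
      by induction (auto simp: unit_vectors_def supported_on_def)
  qed
  show "supported_on I \<subseteq> convex_cone (unit_vectors I)"
  proof
    fix x assume x: "x \<in> supported_on I"
    have "(\<lambda>j. \<bar>x i\<bar> * (if j = i then sgn (x i) else 0)) \<in> convex_cone (unit_vectors I)" if "i \<in> I" for i
    proof (cases "x i = 0")
      case False
      then have "(\<lambda>j. if j = i then sgn (x i) else 0) \<in> unit_vectors I"
        using that unfolding unit_vectors_def
        by (intro image_eqI[of _ _ "(sgn (x i), i)"]) (auto simp: sgn_if)
      then show ?thesis by (intro convex_cone.scale convex_cone.gen) auto
    qed (simp add: convex_cone.zero)
    then have "(\<lambda>j. \<Sum>i\<in>I. \<bar>x i\<bar> * (if j = i then sgn (x i) else 0)) \<in> convex_cone (unit_vectors I)"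
      by (rule convex_cone_sum)
    moreover have "(\<lambda>j. \<Sum>i\<in>I. \<bar>x i\<bar> * (if j = i then sgn (x i) else 0)) = x"
      using x assms by (auto simp: fun_eq_iff supported_on_def sum.delta if_distrib[of "(*) _"] abs_mult_sgn cong: if_cong)
    ultimately show "x \<in> convex_cone (unit_vectors I)" by simp
  qed
qed

lemma linear_on_cone_coord:
  assumes "\<And>g. g \<in> G \<Longrightarrow> g i \<in> \<int>"
  shows "linear_on_cone (\<lambda>x. x i) G"
  using assms by (auto simp: linear_on_cone_def)

lemma unit_vectors_int: "g \<in> unit_vectors I \<Longrightarrow> g i \<in> \<int>"
  by (auto simp: unit_vectors_def)

lemma fan_supported_on:
  assumes "finite I" "finite T" "\<And>t. t \<in> T \<Longrightarrow> h t \<in> pl_functions"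
  shows "\<exists>\<F>. fan (supported_on I) \<F> \<and> (\<forall>t\<in>T. \<forall>G\<in>\<F>. linear_on_cone (h t) G)"
proof (rule fan_refine_finite[OF assms(2,3)])
  show "fan (supported_on I) {unit_vectors I}"
    using assms(1) convex_cone_unit_vectors[OF assms(1)]
    by (auto simp: fan_def unit_vectors_def intro!: linear_on_cone_coord)
qed

text \<open>One direction of the Minkowski-Weyl theorem, with integral generators: starting from the
  signed unit vectors, which generate the whole space, each inequality is one double description
  step.\<close>

lemma integer_cone_finitely_generated:
  fixes A :: "('i \<Rightarrow> real) set"
  assumes "finite I" "finite A" "\<And>a i. a \<in> A \<Longrightarrow> a i \<in> \<int>"
  shows "\<exists>G. finite G \<and> (\<forall>g\<in>G. \<forall>i. g i \<in> \<int>) \<and>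
    convex_cone G = {v \<in> supported_on I. \<forall>a\<in>A. (\<Sum>i\<in>I. a i * v i) \<ge> 0}"
  using assms(2,3)
proof (induction A)
  case empty
  then show ?case using convex_cone_unit_vectors[OF assms(1)] unit_vectors_int assms(1)
    by (intro exI[of _ "unit_vectors I"]) (auto simp: unit_vectors_def)
next
  case (insert a A)
  then obtain G where G: "finite G" "\<forall>g\<in>G. \<forall>i. g i \<in> \<int>"
    "convex_cone G = {v \<in> supported_on I. \<forall>a\<in>A. (\<Sum>i\<in>I. a i * v i) \<ge> 0}" by auto
  let ?D = "\<lambda>v. \<Sum>i\<in>I. a i * v i"
  have D: "linear_on_cone ?D G" unfolding linear_on_cone_def
    using insert.prems G(2)
    by (auto simp: algebra_simps sum.distrib sum_distrib_left intro!: Ints_sum Ints_mult)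
  have "\<forall>g\<in>half_generators ?D G. \<forall>i. g i \<in> \<int>"
    using linear_on_half[OF D linear_on_cone_coord, of i for i] G(2) by (auto simp: linear_on_cone_def)
  moreover have "convex_cone (half_generators ?D G) = {v \<in> convex_cone G. ?D v \<ge> 0}"
    using convex_cone_half[OF D] half_nonneg[OF D] convex_cone_half_subset[of ?D G] by auto
  ultimately show ?case using G finite_half_generators[OF G(1), of ?D]
    by (intro exI[of _ "half_generators ?D G"]) auto
qed

section \<open>Determinants and three-term relations\<close>

text \<open>Rows are kept in a list, so that replacing, swapping and moving rows are list
  operations.\<close>

definition row_det :: "(nat \<Rightarrow> real) list \<Rightarrow> real" where
  "row_det vs = det (mat (length vs) (length vs) (\<lambda>(i, j). (vs ! i) j))"

text \<open>The cofactors along row \<open>i\<close> do not involve that row, so the determinant is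
  a linear functional of \<open>x\<close> with fixed coefficients.\<close>

lemma row_det_update:
  assumes "i < length vs"
  shows "row_det (vs[i := x]) =
    (\<Sum>j<length vs. x j * cofactor (mat (length vs) (length vs) (\<lambda>(i, j). (vs ! i) j)) i j)"
proof -
  let ?n = "length vs"
  let ?M = "mat ?n ?n (\<lambda>(i, j). (vs ! i) j)" and ?M' = "mat ?n ?n (\<lambda>(k, j). (vs[i := x] ! k) j)"
  have "row_det (vs[i := x]) = det ?M'" by (simp add: row_det_def)
  also have "\<dots> = (\<Sum>j<?n. ?M' $$ (i, j) * cofactor ?M' i j)"
    by (rule laplace_expansion_row) (use assms in auto)
  also have "\<dots> = (\<Sum>j<?n. x j * cofactor ?M i j)"
  proof (rule sum.cong)
    fix j assume "j \<in> {..<?n}"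
    then have "mat_delete ?M' i j = mat_delete ?M i j"
      unfolding mat_delete_def using assms by (intro eq_matI) auto
    then show "?M' $$ (i, j) * cofactor ?M' i j = x j * cofactor ?M i j"
      using assms \<open>j \<in> _\<close> by (simp add: cofactor_def)
  qed simp
  finally show ?thesis .
qed

lemma row_det_identical:
  assumes "i < length vs" "j < length vs" "i \<noteq> j" "vs ! i = vs ! j"
  shows "row_det vs = 0"
  unfolding row_det_def
  by (rule det_identical_rows[of _ "length vs" i j]) (use assms in \<open>auto intro!: eq_vecI\<close>)

lemma row_det_swap:
  assumes "i < length vs" "j < length vs" "i \<noteq> j"
  shows "row_det (vs[i := vs ! j, j := vs ! i]) = - row_det vs"
proof -
  let ?n = "length vs"
  let ?M = "mat ?n ?n (\<lambda>(i, j). (vs ! i) j)"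
  have "mat ?n ?n (\<lambda>(k, l). (vs[i := vs ! j, j := vs ! i] ! k) l) = swaprows i j ?M"
    using assms by (intro eq_matI) (auto simp: nth_list_update)
  then show ?thesis
    using det_swaprows[OF assms(1,2,3), of ?M] by (simp add: row_det_def)
qed

lemma row_det_swap_adjacent:
  "row_det (us @ [x, y] @ ws) = - row_det (us @ [y, x] @ ws)"
proof -
  have "(us @ [y, x] @ ws)[length us := (us @ [y, x] @ ws) ! Suc (length us), Suc (length us) := (us @ [y, x] @ ws) ! length us]
    = us @ [x, y] @ ws"
    by (simp add: list_update_append nth_append)
  then show ?thesis
    using row_det_swap[of "length us" "us @ [y, x] @ ws" "Suc (length us)"] by simp
qed

text \<open>Cramer's rule for the row \<open>x\<close>, followed by the linear functional
  \<open>y \<mapsto> row_det (us[k := y])\<close>.\<close>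

lemma row_det_exchange:
  assumes "length us = length vs" "k < length us"
  shows "row_det vs * row_det (us[k := x]) =
    (\<Sum>i<length vs. row_det (vs[i := x]) * row_det (us[k := vs ! i]))"
proof -
  let ?n = "length vs"
  let ?M = "mat ?n ?n (\<lambda>(i, j). (vs ! i) j)"
  define c where "c j = cofactor (mat ?n ?n (\<lambda>(i, j). (us ! i) j)) k j" for j
  have us: "row_det (us[k := y]) = (\<Sum>j<?n. y j * c j)" for y
    using row_det_update[OF assms(2), of y] assms(1) by (simp add: c_def)
  have cramer: "row_det vs * x j = (\<Sum>i<?n. row_det (vs[i := x]) * (vs ! i) j)" if j: "j < ?n" for j
  proof -
    have M: "?M \<in> carrier_mat ?n ?n" by simp
    have adj: "adj_mat ?M * ?M = det ?M \<cdot>\<^sub>m 1\<^sub>m ?n" using adj_mat(3)[OF M] .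
    \<comment> \<open>Entry \<open>(l, j)\<close> of the adjugate times the matrix; only
      \<open>l = j\<close> survives in the sum over \<open>l\<close> below.\<close>
    have ent: "(\<Sum>i<?n. cofactor ?M i l * (vs ! i) j) = (if l = j then det ?M else 0)" if l: "l < ?n" for l
    proof -
      have "(adj_mat ?M * ?M) $$ (l, j) = (\<Sum>i<?n. cofactor ?M i l * (vs ! i) j)"
        using l j by (simp add: adj_mat_def scalar_prod_def lessThan_atLeast0)
      then show ?thesis unfolding adj using l j by (cases "l = j") auto
    qed
    have "(\<Sum>i<?n. row_det (vs[i := x]) * (vs ! i) j)
        = (\<Sum>i<?n. \<Sum>l<?n. x l * (cofactor ?M i l * (vs ! i) j))"
      by (intro sum.cong) (auto simp: row_det_update sum_distrib_right mult.assoc)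
    also have "\<dots> = (\<Sum>l<?n. x l * (\<Sum>i<?n. cofactor ?M i l * (vs ! i) j))"
      by (subst sum.swap) (simp add: sum_distrib_left)
    also have "\<dots> = (\<Sum>l<?n. x l * (if l = j then det ?M else 0))"
      by (intro sum.cong) (auto simp: ent)
    also have "\<dots> = det ?M * x j" using j by (simp add: if_distrib[of "(*) _"] cong: if_cong)
    finally show ?thesis by (simp add: row_det_def)
  qed
  have "row_det vs * row_det (us[k := x]) = (\<Sum>j<?n. (row_det vs * x j) * c j)"
    unfolding us by (simp add: sum_distrib_left mult.assoc)
  also have "\<dots> = (\<Sum>j<?n. \<Sum>i<?n. row_det (vs[i := x]) * ((vs ! i) j * c j))"
    by (intro sum.cong) (auto simp: cramer sum_distrib_right mult.assoc)
  also have "\<dots> = (\<Sum>i<?n. row_det (vs[i := x]) * row_det (us[k := vs ! i]))"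
    unfolding us by (subst sum.swap) (simp add: sum_distrib_left)
  finally show ?thesis .
qed

text \<open>Exchange \<open>c\<close> out of the second factor of \<open>ab * cd\<close> into the
  first. Where \<open>c\<close> replaces a row of \<open>bs\<close>, the other factor gets a
  repeated row, so only the last two positions contribute; one swap fixes the sign.\<close>

lemma row_det_three_term:
  "row_det (bs @ [a, c]) * row_det (bs @ [b, d]) =
   row_det (bs @ [a, b]) * row_det (bs @ [c, d]) + row_det (bs @ [a, d]) * row_det (bs @ [b, c])"
proof -
  let ?m = "length bs"
  let ?vs = "bs @ [a, b]" and ?us = "bs @ [c, d]"
  have upd: "?us[?m := y] = bs @ [y, d]" for y by simp
  have sw: "row_det (bs @ [y, z]) = - row_det (bs @ [z, y])" for y z
    using row_det_swap_adjacent[of bs y z "[]"] by simp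
  have z: "row_det (bs @ [bs ! i, d]) = 0" if "i < ?m" for i
    by (rule row_det_identical[of i _ ?m]) (use that in \<open>auto simp: nth_append\<close>)
  have "row_det ?vs * row_det (bs @ [c, d]) =
      (\<Sum>i<Suc (Suc ?m). row_det (?vs[i := c]) * row_det (bs @ [?vs ! i, d]))"
    using row_det_exchange[of ?us ?vs ?m c] by simp
  also have "\<dots> = row_det (bs @ [c, b]) * row_det (bs @ [a, d]) + row_det (bs @ [a, c]) * row_det (bs @ [b, d])"
    using z by (simp add: nth_append list_update_append)
  finally show ?thesis using sw[of c b] by simp
qed

section \<open>Maximal minors indexed by row sets\<close>

definition set_det :: "(nat \<Rightarrow> nat \<Rightarrow> real) \<Rightarrow> nat set \<Rightarrow> real" where
  "set_det Y S = row_det (map Y (sorted_list_of_set S))"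

lemma row_det_move_last:
  "row_det (us @ [x] @ ws @ zs) = (- 1) ^ length ws * row_det (us @ ws @ [x] @ zs)"
proof (induction ws arbitrary: us)
  case (Cons w ws)
  have "row_det (us @ [x] @ (w # ws) @ zs) = - row_det ((us @ [w]) @ [x] @ ws @ zs)"
    using row_det_swap_adjacent[of us x w "ws @ zs"] by simp
  then show ?case using Cons[of "us @ [w]"] by simp
qed simp

text \<open>Moving \<open>x\<close> behind the rest of \<open>xs\<close> costs one sign for each
  entry from the insertion point on.\<close>

lemma row_det_insort:
  "row_det (map Y (insort x xs @ zs)) =
    (- 1) ^ length (dropWhile (\<lambda>y. y < x) xs) * row_det (map Y (xs @ [x] @ zs))"
proof -
  have "insort x xs = takeWhile (\<lambda>y. y < x) xs @ [x] @ dropWhile (\<lambda>y. y < x) xs"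
    by (induction xs) auto
  then have "row_det (map Y (insort x xs @ zs)) =
    row_det (map Y (takeWhile (\<lambda>y. y < x) xs) @ [Y x] @ map Y (dropWhile (\<lambda>y. y < x) xs) @ map Y zs)"
    by simp
  also have "\<dots> = (- 1) ^ length (dropWhile (\<lambda>y. y < x) xs) *
      row_det ((map Y (takeWhile (\<lambda>y. y < x) xs) @ map Y (dropWhile (\<lambda>y. y < x) xs)) @ [Y x] @ map Y zs)"
    by (subst row_det_move_last) simp
  also have "map Y (takeWhile (\<lambda>y. y < x) xs) @ map Y (dropWhile (\<lambda>y. y < x) xs) = map Y xs"
    by (metis map_append takeWhile_dropWhile_id)
  finally show ?thesis by simp
qed

lemma dropWhile_insort_greater:
  "x < (y :: nat) \<Longrightarrow> sorted xs \<Longrightarrow> dropWhile (\<lambda>z. z < y) (insort x xs) = dropWhile (\<lambda>z. z < y) xs"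
  by (induction xs) auto

text \<open>Inserting the smaller \<open>x\<close> does not change how many entries \<open>y\<close>
  has to pass, so the sign splits into a factor for \<open>x\<close> and a factor for
  \<open>y\<close>, each determined by \<open>B\<close> and that element alone.\<close>

lemma set_det_insert2:
  assumes "finite B" "x \<notin> B" "y \<notin> B" "x < y"
  shows "set_det Y (B \<union> {x, y}) =
    (- 1) ^ length (dropWhile (\<lambda>z. z < x) (sorted_list_of_set B)) *
    (- 1) ^ length (dropWhile (\<lambda>z. z < y) (sorted_list_of_set B)) *
    row_det (map Y (sorted_list_of_set B) @ [Y x, Y y])"
proof -
  let ?bs = "sorted_list_of_set B"
  have "B \<union> {x, y} = insert y (insert x B)" by auto
  then have "sorted_list_of_set (B \<union> {x, y}) = insort y (insort x ?bs)"
    using assms by (simp add: sorted_list_of_set_insert)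
  then have "set_det Y (B \<union> {x, y}) = row_det (map Y (insort y (insort x ?bs) @ []))"
    by (simp add: set_det_def)
  also have "\<dots> = (- 1) ^ length (dropWhile (\<lambda>z. z < y) ?bs) * row_det (map Y (insort x ?bs @ [y]))"
    unfolding row_det_insort[of Y y] using assms by (simp add: dropWhile_insort_greater)
  also have "row_det (map Y (insort x ?bs @ [y])) =
      (- 1) ^ length (dropWhile (\<lambda>z. z < x) ?bs) * row_det (map Y (?bs @ [x] @ [y]))"
    by (rule row_det_insort)
  finally show ?thesis by simp
qed

text \<open>Each of the three products contains \<open>a\<close>, \<open>b\<close>,
  \<open>c\<close>, \<open>d\<close> once and so carries the same total sign; the relation for rows
  placed last carries over.\<close>

lemma set_det_three_term:
  assumes "finite B" "a < b" "b < c" "c < d" "{a, b, c, d} \<inter> B = {}"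
  shows "set_det Y (B \<union> {a, c}) * set_det Y (B \<union> {b, d}) =
    set_det Y (B \<union> {a, b}) * set_det Y (B \<union> {c, d}) + set_det Y (B \<union> {a, d}) * set_det Y (B \<union> {b, c})"
proof -
  let ?s = "\<lambda>x. (- 1 :: real) ^ length (dropWhile (\<lambda>z. z < x) (sorted_list_of_set B))"
  let ?r = "\<lambda>x y. row_det (map Y (sorted_list_of_set B) @ [Y x, Y y])"
  have e: "set_det Y (B \<union> {x, y}) = ?s x * ?s y * ?r x y" if "x \<notin> B" "y \<notin> B" "x < y" for x y
    using set_det_insert2[OF assms(1) that] .
  have es: "set_det Y (B \<union> {a, c}) = ?s a * ?s c * ?r a c" "set_det Y (B \<union> {b, d}) = ?s b * ?s d * ?r b d"
    "set_det Y (B \<union> {a, b}) = ?s a * ?s b * ?r a b" "set_det Y (B \<union> {c, d}) = ?s c * ?s d * ?r c d"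
    "set_det Y (B \<union> {a, d}) = ?s a * ?s d * ?r a d" "set_det Y (B \<union> {b, c}) = ?s b * ?s c * ?r b c"
    by (intro e; use assms(2-5) in auto)+
  have "(sa * sc * ac) * (sb * sd * bd) = (sa * sb * ab) * (sc * sd * cd) + (sa * sd * ad) * (sb * sc * bc)"
    if "ac * bd = ab * cd + ad * bc" for sa sb sc sd ac bd ab cd ad bc :: real
  proof -
    have "(sa * sc * ac) * (sb * sd * bd) = sa * sb * sc * sd * (ac * bd)" by simp
    then show ?thesis unfolding that by (simp add: algebra_simps)
  qed
  from this[OF row_det_three_term] show ?thesis unfolding es .
qed

section \<open>Minors of a matrix as maximal minors of the stacked matrix\<close>

definition list_minor :: "(nat \<Rightarrow> nat \<Rightarrow> real) \<Rightarrow> nat list \<Rightarrow> nat list \<Rightarrow> real" where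
  "list_minor A rs cs = det (mat (length rs) (length rs) (\<lambda>(i, j). A (rs ! i) (cs ! j)))"

text \<open>The rows of \<open>W\<^sub>0\<close> come first, so that an \<open>n\<close>-subset of the \<open>2n\<close> rows is a cyclic shift of
  the label \<open>K\<close> of the same Pluecker coordinate. The signs differ from those of \<open>W\<^sub>0\<close>: with this
  order they must be \<open>(-1)\<^sup>j\<close> for the maximal minors to be the minors of \<open>A\<close>.\<close>

definition stacked :: "nat \<Rightarrow> (nat \<Rightarrow> nat \<Rightarrow> real) \<Rightarrow> nat \<Rightarrow> nat \<Rightarrow> real" where
  "stacked n A r j = (if r < n then if j = n - 1 - r then (- 1) ^ j else 0 else A (r - n) j)"

text \<open>Expand along the rows of the top block one by one. Row \<open>w\<close> has a single
  nonzero entry, in column \<open>n - 1 - w\<close>, which the prefix condition on \<open>cs\<close>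
  locates at that very position; the sign of the entry cancels that of the cofactor.\<close>

lemma list_minor_stacked:
  assumes "sorted_wrt (<) ws" "\<forall>w\<in>set ws. w < n" "distinct cs" "\<forall>c\<in>set cs. c < n"
    and "length cs = length ws + length rs"
    and "ws \<noteq> [] \<Longrightarrow> take (n - hd ws) cs = [0..<n - hd ws]"
  shows "list_minor (stacked n A) (ws @ rs) cs =
    list_minor (stacked n A) rs (filter (\<lambda>c. n - 1 - c \<notin> set ws) cs)"
  using assms
proof (induction ws arbitrary: cs)
  case (Cons w ws)
  define c where "c = n - 1 - w"
  have w: "w < n" using Cons.prems by simp
  have c: "n - w = Suc c" "c < n" "w = n - 1 - c" using w by (auto simp: c_def)
  have tk: "take (Suc c) cs = [0..<Suc c]" using Cons.prems(6) c(1) by simp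
  then have lc: "c < length cs" by (metis length_take length_upt min.absorb_iff2 min.cobounded2 diff_zero Suc_le_eq min_def)
  have csn: "cs ! i = i" if "i \<le> c" for i
    using arg_cong[OF tk, of "\<lambda>l. l ! i"] that by (simp del: upt_Suc)
  let ?m = "length cs"
  let ?M = "mat ?m ?m (\<lambda>(i, j). stacked n A (((w # ws) @ rs) ! i) (cs ! j))"
  have m: "?m = Suc (length ws + length rs)" using Cons.prems by simp
  let ?cs' = "take c cs @ drop (Suc c) cs"
  have cs: "cs = take c cs @ c # drop (Suc c) cs" using id_take_nth_drop[OF lc] csn[of c] by simp
  have dist: "distinct (take c cs @ c # drop (Suc c) cs)" using Cons.prems(3) cs by simp
  have M0: "?M $$ (0, j) = (if j = c then (- 1) ^ c else 0)" if "j < ?m" for j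
  proof -
    have "cs ! j = c \<longleftrightarrow> j = c"
      using csn[of c] nth_eq_iff_index_eq[OF Cons.prems(3) that lc] by simp
    then show ?thesis using that w m csn[of c] by (simp add: stacked_def c_def)
  qed
  have del: "mat_delete ?M 0 c = mat (?m - 1) (?m - 1) (\<lambda>(i, j). stacked n A ((ws @ rs) ! i) (?cs' ! j))"
    unfolding mat_delete_def
    by (intro eq_matI) (use lc in \<open>auto simp: nth_append min_def\<close>)
  have "list_minor (stacked n A) ((w # ws) @ rs) cs = det ?M"
    using Cons.prems(5) by (simp add: list_minor_def)
  also have "\<dots> = (\<Sum>j<?m. ?M $$ (0, j) * cofactor ?M 0 j)"
    by (rule laplace_expansion_row) (use m in auto)
  also have "\<dots> = (\<Sum>j<?m. if j = c then (- 1) ^ c * cofactor ?M 0 j else 0)"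
  proof (rule sum.cong)
    fix j assume "j \<in> {..<?m}"
    then show "?M $$ (0, j) * cofactor ?M 0 j = (if j = c then (- 1) ^ c * cofactor ?M 0 j else 0)"
      using M0[of j] by (auto simp del: index_mat(1))
  qed simp
  also have "\<dots> = (- 1) ^ c * cofactor ?M 0 c" using lc by simp
  also have "\<dots> = det (mat_delete ?M 0 c)"
    by (simp add: cofactor_def flip: mult.assoc power_add)
  also have "\<dots> = list_minor (stacked n A) (ws @ rs) ?cs'"
    unfolding del using m by (simp add: list_minor_def)
  also have "\<dots> = list_minor (stacked n A) rs (filter (\<lambda>c. n - 1 - c \<notin> set ws) ?cs')"
  proof (rule Cons.IH)
    show "sorted_wrt (<) ws" "\<forall>w\<in>set ws. w < n" "\<forall>c\<in>set ?cs'. c < n"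
      using Cons.prems by (auto dest: in_set_takeD in_set_dropD)
    show "distinct ?cs'" using dist by simp
    show "length ?cs' = length ws + length rs" using lc m by simp
    assume "ws \<noteq> []"
    then have "hd ws > w" using Cons.prems(1) by (cases ws) auto
    \<comment> \<open>Later rows of the top block are larger, hence their columns lie to the left of
      \<open>c\<close> and stay in place after the deletion.\<close>
    then have le: "n - hd ws \<le> c" using w by (simp add: c_def)
    have "take (n - hd ws) ?cs' = take (n - hd ws) (take (Suc c) cs)" using le lc by simp
    also have "\<dots> = [0..<n - hd ws]" using tk le by (simp add: take_upt del: upt_Suc)
    finally show "take (n - hd ws) ?cs' = [0..<n - hd ws]" .
  qed
  also have "filter (\<lambda>c. n - 1 - c \<notin> set ws) ?cs' = filter (\<lambda>c. n - 1 - c \<notin> set (w # ws)) cs"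
  proof -
    have "filter (\<lambda>d. n - 1 - d \<notin> set (w # ws)) cs =
        filter (\<lambda>d. n - 1 - d \<notin> set (w # ws)) (take c cs @ c # drop (Suc c) cs)"
      using cs by simp
    also have "\<dots> = filter (\<lambda>d. n - 1 - d \<notin> set (w # ws)) ?cs'"
      using c(3) by simp
    also have "\<dots> = filter (\<lambda>d. n - 1 - d \<notin> set ws) ?cs'"
    proof (rule filter_cong[OF refl])
      fix d assume d: "d \<in> set ?cs'"
      then have "d \<noteq> c" using dist by auto
      moreover have "d < n" using d Cons.prems(4) by (auto dest: in_set_takeD in_set_dropD)
      ultimately have "n - 1 - d \<noteq> w" using c by auto
      then show "(n - 1 - d \<notin> set (w # ws)) = (n - 1 - d \<notin> set ws)" by simp
    qed
    finally show ?thesis by simp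
  qed
  finally show ?case .
qed simp

text \<open>Indices start at 0. The top rows taken are those whose nonzero columns lie outside
  \<open>J\<close>: expanding along them removes these columns and leaves the minor with columns
  \<open>J\<close>.\<close>

definition stacked_set :: "nat \<Rightarrow> nat set \<Rightarrow> nat set \<Rightarrow> nat set" where
  "stacked_set n I J = (\<lambda>c. n - 1 - c) ` ({..<n} - J) \<union> (+) n ` I"

lemma stacked_set_subset: "I \<subseteq> {..<n} \<Longrightarrow> stacked_set n I J \<subseteq> {..<2 * n}"
  by (auto simp: stacked_set_def)

lemma inj_on_rev_nat: "inj_on (\<lambda>c. n - 1 - c) ({..<n} - (J :: nat set))"
  by (auto simp: inj_on_def)

lemma card_stacked_set:
  assumes "I \<subseteq> {..<n}" "J \<subseteq> {..<n}" "card I = card J"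
  shows "card (stacked_set n I J) = n"
proof -
  have f: "finite I" "finite J" using assms finite_subset by auto
  have "card (stacked_set n I J) = card ((\<lambda>c. n - 1 - c) ` ({..<n} - J)) + card ((+) n ` I)"
    unfolding stacked_set_def using f by (intro card_Un_disjoint) auto
  also have "\<dots> = (n - card J) + card I"
    unfolding card_image[OF inj_on_rev_nat] using f assms(2) by (simp add: card_image card_Diff_subset)
  also have "\<dots> = n" using assms card_mono[OF _ assms(2)] by simp
  finally show ?thesis .
qed

lemma sorted_list_of_set_eqI:
  "sorted_wrt (<) xs \<Longrightarrow> set xs = A \<Longrightarrow> sorted_list_of_set A = (xs :: nat list)"
  by (auto simp: sorted_list_of_set_sort_remdups strict_sorted_iff distinct_remdups_id sorted_sort_id)

lemma set_det_stacked_set: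
  assumes "I \<subseteq> {..<n}" "J \<subseteq> {..<n}" "card I = card J"
  shows "set_det (stacked n A) (stacked_set n I J) =
    list_minor A (sorted_list_of_set I) (sorted_list_of_set J)"
proof -
  let ?W = "(\<lambda>c. n - 1 - c) ` ({..<n} - J)"
  let ?ws = "sorted_list_of_set ?W" and ?is = "sorted_list_of_set I"
  let ?rs = "map ((+) n) ?is"
  have f: "finite I" "finite J" using assms finite_subset by auto
  have sl: "sorted_list_of_set (stacked_set n I J) = ?ws @ ?rs"
    by (rule sorted_list_of_set_eqI)
      (use f in \<open>auto simp: sorted_wrt_append sorted_wrt_map stacked_set_def intro: strict_sorted_list_of_set\<close>)
  have len: "length (?ws @ ?rs) = n"
    using card_stacked_set[OF assms] sl by (metis length_sorted_list_of_set)
  have "set_det (stacked n A) (stacked_set n I J) = list_minor (stacked n A) (?ws @ ?rs) [0..<n]"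
    unfolding set_det_def sl row_det_def list_minor_def using len
    by (intro arg_cong[of _ _ det] eq_matI) (auto simp del: map_append)
  also have "\<dots> = list_minor (stacked n A) ?rs (filter (\<lambda>c. n - 1 - c \<notin> set ?ws) [0..<n])"
  proof (rule list_minor_stacked)
    show "\<forall>w\<in>set ?ws. w < n" by auto
    show "length [0..<n] = length ?ws + length ?rs" using len by simp
    show "take (n - hd ?ws) [0..<n] = [0..<n - hd ?ws]" by (simp add: take_upt)
  qed auto
  also have "filter (\<lambda>c. n - 1 - c \<notin> set ?ws) [0..<n] = sorted_list_of_set J"
  proof (rule sorted_list_of_set_eqI[symmetric])
    show "sorted_wrt (<) (filter (\<lambda>c. n - 1 - c \<notin> set ?ws) [0..<n])"
      by (intro sorted_wrt_filter) simp
    have "n - 1 - c \<in> ?W \<longleftrightarrow> c \<notin> J" if "c < n" for c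
    proof
      assume "n - 1 - c \<in> ?W"
      then obtain d where "d < n" "d \<notin> J" "n - 1 - c = n - 1 - d" by auto
      with that have "d = c" by linarith
      with \<open>d \<notin> J\<close> show "c \<notin> J" by simp
    qed (use that in auto)
    then show "set (filter (\<lambda>c. n - 1 - c \<notin> set ?ws) [0..<n]) = J"
      using assms(2) by auto
  qed
  also have "list_minor (stacked n A) ?rs (sorted_list_of_set J) = list_minor A ?is (sorted_list_of_set J)"
    unfolding list_minor_def by (intro arg_cong[of _ _ det] eq_matI) (auto simp: stacked_def)
  finally show ?thesis .
qed

section \<open>Minors with 1-based labels in terms of index lists\<close>

lemma pick_eq_sorted_list_of_set:
  assumes "finite I" "i < card I"
  shows "pick I i = sorted_list_of_set I ! i"
proof -
  let ?xs = "map (pick I) [0..<card I]"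
  have "sorted_wrt (<) ?xs" by (auto simp: sorted_wrt_iff_nth_less pick_mono_le)
  moreover have "set ?xs = I"
  proof (rule card_subset_eq[OF assms(1)])
    show "set ?xs \<subseteq> I" by (auto simp: pick_in_set_le)
    show "card (set ?xs) = card I"
      using \<open>sorted_wrt (<) ?xs\<close> distinct_card[of ?xs] by (simp add: strict_sorted_iff)
  qed
  ultimately have "sorted_list_of_set I = ?xs" by (rule sorted_list_of_set_eqI)
  then show ?thesis using assms(2) by simp
qed

lemma Suc_vimage_index_set:
  assumes "I \<subseteq> {1..n}"
  shows "{i. Suc i \<in> I} \<subseteq> {..<n}" "card {i. Suc i \<in> I} = card I"
proof -
  show "{i. Suc i \<in> I} \<subseteq> {..<n}" using assms by auto
  have "x \<in> Suc ` {i. Suc i \<in> I}" if "x \<in> I" for x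
    using that assms by (cases x) auto
  then have "Suc ` {i. Suc i \<in> I} = I" by auto
  then show "card {i. Suc i \<in> I} = card I" by (metis card_image inj_Suc)
qed

lemma minor_eq_list_minor:
  assumes "X \<in> carrier_mat n n" "I \<subseteq> {1..n}" "J \<subseteq> {1..n}" "card I = card J"
  shows "minor X I J = list_minor (\<lambda>i j. X $$ (i, j))
    (sorted_list_of_set {i. Suc i \<in> I}) (sorted_list_of_set {j. Suc j \<in> J})"
proof -
  let ?I = "{i. Suc i \<in> I}" and ?J = "{j. Suc j \<in> J}"
  note I = Suc_vimage_index_set[OF assms(2)] and J = Suc_vimage_index_set[OF assms(3)]
  have fin: "finite ?I" "finite ?J"
    using finite_subset[OF I(1)] finite_subset[OF J(1)] by simp_all
  have "{i. i < n \<and> i \<in> ?I} = ?I" "{j. j < n \<and> j \<in> ?J} = ?J"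
    using I(1) J(1) by auto
  then have "submatrix X ?I ?J = mat (card ?I) (card ?J) (\<lambda>(i, j). X $$ (pick ?I i, pick ?J j))"
    using assms(1) by (simp add: submatrix_def)
  also have "\<dots> = mat (card ?I) (card ?I)
      (\<lambda>(i, j). X $$ (sorted_list_of_set ?I ! i, sorted_list_of_set ?J ! j))"
    using I(2) J(2) assms(4)
    by (intro eq_matI)
      (simp_all add: pick_eq_sorted_list_of_set[OF fin(1)] pick_eq_sorted_list_of_set[OF fin(2)])
  finally show ?thesis by (simp add: minor_def list_minor_def)
qed

section \<open>Matrices with prescribed initial minors\<close>

text \<open>By expansion along the last row, changing the bottom right entry by \<delta> adds
  \<delta> times its cofactor, and the sign at a diagonal position is positive.\<close>

lemma list_minor_update_last:
  assumes "length rs = Suc m" "length cs = Suc m" "distinct rs" "distinct cs"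
  shows "list_minor (A(last rs := (A (last rs))(last cs := A (last rs) (last cs) + \<delta>))) rs cs =
    list_minor A rs cs + \<delta> * list_minor A (butlast rs) (butlast cs)"
proof -
  let ?A' = "A(last rs := (A (last rs))(last cs := A (last rs) (last cs) + \<delta>))"
  have ls: "last rs = rs ! m" "last cs = cs ! m"
    using assms by (metis last_conv_nth diff_Suc_1 length_0_conv nat.distinct(1))+
  define vs where "vs = map (\<lambda>r k. A r (cs ! k)) rs"
  have lv: "length vs = Suc m" by (simp add: vs_def assms)
  let ?M = "mat (Suc m) (Suc m) (\<lambda>(i, j). (vs ! i) j)"
  have A: "list_minor A rs cs = row_det (vs[m := vs ! m])"
    unfolding list_minor_def row_det_def vs_def using assms
    by (intro arg_cong[of _ _ det] eq_matI) (auto simp: nth_list_update)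
  have rs: "rs ! i = rs ! m \<longleftrightarrow> i = m" "cs ! i = cs ! m \<longleftrightarrow> i = m" if "i < Suc m" for i
    using assms that by (simp_all add: nth_eq_iff_index_eq)
  have A': "list_minor ?A' rs cs = row_det (vs[m := (vs ! m)(m := (vs ! m) m + \<delta>)])"
    unfolding list_minor_def row_det_def vs_def using assms
    by (intro arg_cong[of _ _ det] eq_matI) (auto simp: ls rs nth_list_update)
  have del: "mat_delete ?M m m = mat m m (\<lambda>(i, j). A (butlast rs ! i) (butlast cs ! j))"
    unfolding mat_delete_def vs_def using assms by (intro eq_matI) (auto simp: nth_butlast)
  have "list_minor ?A' rs cs = (\<Sum>j<Suc m. ((vs ! m)(m := (vs ! m) m + \<delta>)) j * cofactor ?M m j)"
    unfolding A' by (subst row_det_update) (simp_all add: lv)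
  also have "\<dots> = (\<Sum>j<Suc m. (vs ! m) j * cofactor ?M m j) + \<delta> * cofactor ?M m m"
    by (simp add: algebra_simps)
  also have "(\<Sum>j<Suc m. (vs ! m) j * cofactor ?M m j) = list_minor A rs cs"
    unfolding A by (subst row_det_update) (simp_all add: lv)
  also have "cofactor ?M m m = list_minor A (butlast rs) (butlast cs)"
    unfolding cofactor_def del list_minor_def using assms by (simp flip: power_add mult_2)
  finally show ?thesis .
qed

lemma list_minor_cong:
  assumes "\<And>r c. r \<in> set rs \<Longrightarrow> c \<in> set cs \<Longrightarrow> A r c = A' r c" "length rs = length cs"
  shows "list_minor A rs cs = list_minor A' rs cs"
  unfolding list_minor_def using assms by (intro arg_cong[of _ _ det] eq_matI) auto

text \<open>The solid minor with bottom right corner \<open>(i, j)\<close> that extends up and left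
  until it meets the first row or column: an initial minor, with 0-based indices.\<close>

abbreviation corner_minor :: "(nat \<Rightarrow> nat \<Rightarrow> real) \<Rightarrow> nat \<Rightarrow> nat \<Rightarrow> real" where
  "corner_minor A i j \<equiv> list_minor A [i - min i j..<Suc i] [j - min i j..<Suc j]"

text \<open>Entries are fixed in reading order, numbered by \<open>i * n + j\<close>. An entry is
  the bottom right corner of its own minor, which depends on it affinely. The slope is the corner
  minor at \<open>(i - 1, j - 1)\<close>, already prescribed and positive, or the empty minor 1 on
  the border.\<close>

lemma exists_corner_minors:
  assumes v: "\<And>i j. v i j > (0 :: real)"
  shows "\<exists>A. \<forall>i<n. \<forall>j<n. corner_minor A i j = v i j"
proof -
  have "\<exists>A. \<forall>i<n. \<forall>j<n. i * n + j < t \<longrightarrow> corner_minor A i j = v i j" if "t \<le> n * n" for t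
    using that
  proof (induction t)
    case (Suc t)
    then obtain A where A: "\<forall>i<n. \<forall>j<n. i * n + j < t \<longrightarrow> corner_minor A i j = v i j" by auto
    have n: "n > 0" using Suc.prems by (cases n) auto
    define i0 j0 where "i0 = t div n" and "j0 = t mod n"
    have t: "t = i0 * n + j0" "j0 < n" using n by (auto simp: i0_def j0_def)
    have i0: "i0 < n" using Suc.prems n by (simp add: i0_def less_mult_imp_div_less)
    let ?rs = "[i0 - min i0 j0..<Suc i0]" and ?cs = "[j0 - min i0 j0..<Suc j0]"
    let ?q = "list_minor A (butlast ?rs) (butlast ?cs)"
    have q: "?q > 0"
    proof (cases "i0 = 0 \<or> j0 = 0")
      case True
      then show ?thesis by (auto simp: list_minor_def)
    next
      case False
      then obtain i j where ij: "i0 = Suc i" "j0 = Suc j" by (metis not0_implies_Suc)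
      have "butlast [l..<Suc u] = [l..<u]" if "l \<le> u" for l u :: nat using that by simp
      then have "?q = corner_minor A i j" unfolding ij by (simp del: upt_Suc)
      moreover have "i * n + j < t" using ij t by auto
      ultimately show ?thesis using A v ij i0 t(2) by auto
    qed
    define \<delta> where "\<delta> = (v i0 j0 - list_minor A ?rs ?cs) / ?q"
    define A' where "A' = A(i0 := (A i0)(j0 := A i0 j0 + \<delta>))"
    have "list_minor A' ?rs ?cs = list_minor A ?rs ?cs + \<delta> * ?q"
      unfolding A'_def using list_minor_update_last[of ?rs "min i0 j0" ?cs A \<delta>] by simp
    then have new: "corner_minor A' i0 j0 = v i0 j0" using q by (simp add: \<delta>_def)
    have "corner_minor A' i j = v i j" if ij: "i < n" "j < n" "i * n + j < Suc t" for i j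
    proof (cases "i * n + j < t")
      case True
      have "i < i0 \<or> i = i0 \<and> j < j0"
      proof (rule ccontr)
        assume neg: "\<not> ?thesis"
        show False
        proof (cases "i = i0")
          case False
          then have "Suc i0 \<le> i" using neg by simp
          then have "Suc i0 * n \<le> i * n" by (rule mult_le_mono1)
          with True t show False by simp
        qed (use neg True t in simp)
      qed
      \<comment> \<open>An earlier corner minor uses only rows up to \<open>i\<close> and columns up
        to \<open>j\<close>, so it does not see the changed entry.\<close>
      then have "corner_minor A' i j = corner_minor A i j"
        by (intro list_minor_cong) (auto simp: A'_def)
      then show ?thesis using A ij True by auto
    next
      case False
      then have "i * n + j = t" using ij by simp
      then have "i = i0" "j = j0" using ij by (auto simp: i0_def j0_def)
      then show ?thesis using new by simp
    qed
    then show ?case by blast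
  qed auto
  from this[of "n * n"] obtain A where A: "\<forall>i<n. \<forall>j<n. i * n + j < n * n \<longrightarrow> corner_minor A i j = v i j" by auto
  have "i * n + j < n * n" if "i < n" "j < n" for i j
  proof -
    have "Suc i * n \<le> n * n" using that by (intro mult_le_mono1) simp
    then show ?thesis using that by simp
  qed
  with A show ?thesis by blast
qed

section \<open>Tropical approximation of Pluecker coordinates\<close>

definition three_term :: "(nat set \<Rightarrow> real) \<Rightarrow> bool" where
  "three_term p \<longleftrightarrow> (\<forall>B a b c d. finite B \<and> a < b \<and> b < c \<and> c < d \<and> {a, b, c, d} \<inter> B = {} \<longrightarrow>
     p (B \<union> {a, c}) * p (B \<union> {b, d}) = p (B \<union> {a, b}) * p (B \<union> {c, d}) + p (B \<union> {a, d}) * p (B \<union> {b, c}))"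

text \<open>The rectangle cluster of the Grassmannian. For the stacked matrix these are the row sets of
  the initial minors, i.e. the solid minors that touch the first row or the first column.\<close>

definition initial_sets :: "nat \<Rightarrow> nat \<Rightarrow> nat set set" where
  "initial_sets N k = {{0..<a} \<union> {b..<b + (k - a)} | a b. a \<le> b \<and> a \<le> k \<and> b + (k - a) \<le> N}"

lemma ln_add_max:
  assumes "x > 0" "y > (0 :: real)"
  shows "\<bar>ln (x + y) - max (ln x) (ln y)\<bar> \<le> ln 2"
proof -
  have m: "max (ln x) (ln y) = ln (max x y)" using assms by (simp add: max_def)
  have "ln (max x y) \<le> ln (x + y)" using assms by (subst ln_le_cancel_iff) auto
  moreover have "ln (x + y) \<le> ln (2 * max x y)" using assms by (subst ln_le_cancel_iff) auto
  moreover have "ln (2 * max x y) = ln 2 + ln (max x y)" using assms by (subst ln_mult) auto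
  ultimately show ?thesis using m by simp
qed

text \<open>The formula \<open>s = (q1 * q2 + q3 * q4) / q5\<close> has no subtraction, whence
  \<open>s > 0\<close>. In logarithms the five given errors add up, and replacing the sum by a
  maximum costs a further \<open>ln 2\<close>.\<close>

lemma ln_exchange:
  assumes "q1 > 0" "q2 > 0" "q3 > 0" "q4 > 0" "q5 > (0 :: real)" "q5 * s = q1 * q2 + q3 * q4"
    and "\<bar>ln q1 - t1\<bar> \<le> c1" "\<bar>ln q2 - t2\<bar> \<le> c2" "\<bar>ln q3 - t3\<bar> \<le> c3" "\<bar>ln q4 - t4\<bar> \<le> c4"
    and "\<bar>ln q5 - t5\<bar> \<le> c5"
  shows "s > 0 \<and> \<bar>ln s - (max (t1 + t2) (t3 + t4) - t5)\<bar> \<le> c1 + c2 + c3 + c4 + c5 + ln 2"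
proof -
  have p: "q1 * q2 > 0" "q3 * q4 > 0" using assms by auto
  then have "q5 * s > 0" using assms(6) by linarith
  then have s: "s > 0" using assms(5) by (simp add: zero_less_mult_iff)
  have "ln q5 + ln s = ln (q1 * q2 + q3 * q4)" using assms(5,6) s by (simp flip: ln_mult_pos)
  moreover have "ln (q1 * q2) = ln q1 + ln q2" "ln (q3 * q4) = ln q3 + ln q4"
    by (simp_all add: ln_mult_pos assms(1-4))
  ultimately have e: "ln q5 + ln s = ln (q1 * q2 + q3 * q4)"
    "\<bar>ln (q1 * q2 + q3 * q4) - max (ln q1 + ln q2) (ln q3 + ln q4)\<bar> \<le> ln 2"
    using ln_add_max[OF p] by simp_all
  have bd: "t1 - c1 \<le> ln q1" "ln q1 \<le> t1 + c1" "t2 - c2 \<le> ln q2" "ln q2 \<le> t2 + c2"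
    "t3 - c3 \<le> ln q3" "ln q3 \<le> t3 + c3" "t4 - c4 \<le> ln q4" "ln q4 \<le> t4 + c4"
    "t5 - c5 \<le> ln q5" "ln q5 \<le> t5 + c5"
    using assms(7-11) by (simp_all add: abs_le_iff)
  define m m' where "m = max (ln q1 + ln q2) (ln q3 + ln q4)" and "m' = max (t1 + t2) (t3 + t4)"
  have "m \<le> m' + (c1 + c2 + c3 + c4)" unfolding m_def
    by (rule max.boundedI) (use bd in \<open>simp_all add: m'_def max_def\<close>)
  moreover have "m' \<le> m + (c1 + c2 + c3 + c4)" unfolding m'_def
    by (rule max.boundedI) (use bd in \<open>simp_all add: m_def max_def\<close>)
  ultimately have "\<bar>ln s - (m' - t5)\<bar> \<le> c1 + c2 + c3 + c4 + c5 + ln 2"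
    using e[folded m_def] bd(9,10) by linarith
  with s show ?thesis by (simp add: m'_def)
qed

text \<open>The function \<open>h\<close> and the error \<open>c\<close> are chosen before
  \<open>p\<close> and \<open>w\<close>, so the estimate is uniform over all matrices. Positivity of
  \<open>p S\<close> is included because it has to be derived from positivity on
  \<open>E\<close>.\<close>

definition tropical_approx :: "nat set set \<Rightarrow> nat set \<Rightarrow> ((nat set \<Rightarrow> real) \<Rightarrow> real) \<Rightarrow> real \<Rightarrow> bool" where
  "tropical_approx E S h c \<longleftrightarrow> h \<in> pl_functions \<and> (\<forall>p w. three_term p \<and> (\<forall>T\<in>E. p T > 0 \<and> w T = ln (p T))
     \<longrightarrow> p S > 0 \<and> \<bar>ln (p S) - h w\<bar> \<le> c)"

lemma tropical_approx_exchange: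
  assumes B: "finite B" "a < x" "x < y" "y < z" "{a, x, y, z} \<inter> B = {}"
    and "tropical_approx E (B \<union> {a, x}) h1 c1" "tropical_approx E (B \<union> {y, z}) h2 c2"
    and "tropical_approx E (B \<union> {a, z}) h3 c3" "tropical_approx E (B \<union> {x, y}) h4 c4"
    and "tropical_approx E (B \<union> {a, y}) h5 c5"
  shows "tropical_approx E (B \<union> {x, z}) (\<lambda>w. max (h1 w + h2 w) (h3 w + h4 w) - h5 w)
    (c1 + c2 + c3 + c4 + c5 + ln 2)"
  unfolding tropical_approx_def
proof (intro conjI allI impI)
  show "(\<lambda>w. max (h1 w + h2 w) (h3 w + h4 w) - h5 w) \<in> pl_functions"
    using assms by (auto simp: tropical_approx_def intro!: pl_functions.intros(2-4))
next
  fix p :: "nat set \<Rightarrow> real" and w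
  assume p: "three_term p \<and> (\<forall>T\<in>E. p T > 0 \<and> w T = ln (p T))"
  then have "p (B \<union> {a, y}) * p (B \<union> {x, z}) =
      p (B \<union> {a, x}) * p (B \<union> {y, z}) + p (B \<union> {a, z}) * p (B \<union> {x, y})"
    using B unfolding three_term_def by blast
  then have "p (B \<union> {x, z}) > 0 \<and> \<bar>ln (p (B \<union> {x, z})) -
      (max (h1 w + h2 w) (h3 w + h4 w) - h5 w)\<bar> \<le> c1 + c2 + c3 + c4 + c5 + ln 2"
    using assms(6-10) p unfolding tropical_approx_def
    by (intro ln_exchange[of "p (B \<union> {a, x})" "p (B \<union> {y, z})" "p (B \<union> {a, z})" "p (B \<union> {x, y})" "p (B \<union> {a, y})"]) blast+
  then show "p (B \<union> {x, z}) > 0" "\<bar>ln (p (B \<union> {x, z})) -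
      (max (h1 w + h2 w) (h3 w + h4 w) - h5 w)\<bar> \<le> c1 + c2 + c3 + c4 + c5 + ln 2" by auto
qed

lemma tropical_approx_initial:
  assumes "S \<in> E"
  shows "tropical_approx E S (\<lambda>w. w S) 0"
  using assms by (auto simp: tropical_approx_def intro: pl_functions.coord)

text \<open>A gap \<open>y\<close> between the extreme elements \<open>x < z\<close> of \<open>L\<close> gives a three-term relation for
  \<open>a < x < y < z\<close> in which every other set has a longer initial segment or a smaller spread.\<close>

lemma tropical_approx_exists:
  assumes "L \<subseteq> {a..<N}" "a \<le> k" "card L = k - a" "k \<le> N"
  shows "\<exists>h c. tropical_approx (initial_sets N k) ({0..<a} \<union> L) h c"
  using assms(1-3)
proof (induction "k - a" arbitrary: a L)
  case 0
  then have "L = {}" "a = k" using finite_subset by fastforce+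
  then have "{0..<a} \<union> L \<in> initial_sets N k"
    using assms(4) unfolding initial_sets_def
    by (intro CollectI exI[of _ a] exI[of _ a]) auto
  then show ?case using tropical_approx_initial by blast
next
  case (Suc d)
  from Suc.prems Suc.hyps(2) show ?case
  \<comment> \<open>The outer induction lengthens the initial segment \<open>{0..<a}\<close>; for
    fixed \<open>a\<close> the inner one shrinks the spread of \<open>L\<close>.\<close>
  proof (induction "Max L - Min L" arbitrary: L rule: less_induct)
    case less
    have fin: "finite L" using less.prems finite_subset by blast
    have ne: "L \<noteq> {}" using less.prems by auto
    have d: "d = k - Suc a" "Suc a \<le> k" using less.prems by auto
    show ?case
    proof (cases "a \<in> L")
      case True
      have "{0..<a} \<union> L = {0..<Suc a} \<union> (L - {a})" using True by (auto simp: less_Suc_eq)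
      moreover have "L - {a} \<subseteq> {Suc a..<N}" using less.prems(1) by auto
      moreover have "card (L - {a}) = k - Suc a" using True fin less.prems by simp
      ultimately show ?thesis using Suc.hyps(1)[OF d(1) _ d(2)] by simp
    next
      case False
      define x z where "x = Min L" and "z = Max L"
      have xz: "x \<in> L" "z \<in> L" "\<And>u. u \<in> L \<Longrightarrow> x \<le> u \<and> u \<le> z"
        using fin ne by (auto simp: x_def z_def)
      have L: "L \<subseteq> {Suc a..<N}" proof
        fix u assume "u \<in> L"
        then show "u \<in> {Suc a..<N}" using less.prems(1) False by (cases "u = a") auto
      qed
      show ?thesis
      proof (cases "{x..z} \<subseteq> L")
        case True
        then have "L = {x..z}" using xz by auto
        moreover have "x \<le> z" using xz by auto
        ultimately have "L = {x..<x + (k - a)}" using less.prems(3) by auto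
        moreover have "x + (k - a) \<le> N" using calculation \<open>L = {x..z}\<close> less.prems(1,3) \<open>x \<le> z\<close> by auto
        moreover have "a \<le> x" using L xz by auto
        ultimately have "{0..<a} \<union> L \<in> initial_sets N k"
          using less.prems(2) unfolding initial_sets_def by blast
        then show ?thesis using tropical_approx_initial by blast
      next
        case gap: False
        then obtain y where "y \<in> {x..z}" "y \<notin> L" by blast
        with xz have y: "x < y" "y < z" "y \<notin> L" by (auto simp: order.order_iff_strict)
        have ax: "a < x" using L xz by auto
        let ?B = "{0..<a} \<union> (L - {x, z})"
        have c2: "card (L - {x, z}) = k - a - 2" "k - a \<ge> 2"
          using xz y fin less.prems(3) card_mono[OF fin, of "{x, z}"] by (auto simp: card_Diff_subset)
        have sets: "?B \<union> {a, y} = {0..<Suc a} \<union> (insert y (L - {x, z}))"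
          "?B \<union> {a, x} = {0..<Suc a} \<union> (L - {z})"
          "?B \<union> {a, z} = {0..<Suc a} \<union> (L - {x})"
          "?B \<union> {y, z} = {0..<a} \<union> insert y (L - {x})"
          "?B \<union> {x, y} = {0..<a} \<union> insert y (L - {z})"
          "?B \<union> {x, z} = {0..<a} \<union> L"
          using xz y by auto
        have yN: "y \<in> {Suc a..<N}" using y ax xz L by auto
        have ex1: "\<exists>h c. tropical_approx (initial_sets N k) (?B \<union> {a, y}) h c"
          unfolding sets by (rule Suc.hyps(1)[OF d(1) _ d(2)]) (use L yN c2 y fin in auto)
        have ex2: "\<exists>h c. tropical_approx (initial_sets N k) (?B \<union> {a, x}) h c"
          unfolding sets by (rule Suc.hyps(1)[OF d(1) _ d(2)]) (use L xz less.prems(3) fin in auto)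
        have ex3: "\<exists>h c. tropical_approx (initial_sets N k) (?B \<union> {a, z}) h c"
          unfolding sets by (rule Suc.hyps(1)[OF d(1) _ d(2)]) (use L xz less.prems(3) fin in auto)
        have ex4: "\<exists>h c. tropical_approx (initial_sets N k) (?B \<union> {y, z}) h c"
          unfolding sets
        proof (rule less.hyps[OF _ _ less.prems(2) _ less.prems(4)])
          let ?L = "insert y (L - {x})"
          have "finite ?L" using fin by simp
          then have mem: "Max ?L \<in> ?L" "Min ?L \<in> ?L" using Max_in[of ?L] Min_in[of ?L] by blast+
          have "x < u \<and> u \<le> z" if "u \<in> ?L" for u
            using that xz y by (auto simp: order.order_iff_strict)
          with mem have "Max ?L \<le> z" "x < Min ?L" by blast+
          then show "Max ?L - Min ?L < Max L - Min L" using y unfolding x_def[symmetric] z_def[symmetric] by linarith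
          show "?L \<subseteq> {a..<N}" using L yN by auto
          show "card ?L = k - a" using fin xz y less.prems(3) c2 by simp
        qed
        have ex5: "\<exists>h c. tropical_approx (initial_sets N k) (?B \<union> {x, y}) h c"
          unfolding sets
        proof (rule less.hyps[OF _ _ less.prems(2) _ less.prems(4)])
          let ?L = "insert y (L - {z})"
          have "finite ?L" using fin by simp
          then have mem: "Max ?L \<in> ?L" "Min ?L \<in> ?L" using Max_in[of ?L] Min_in[of ?L] by blast+
          have "x \<le> u \<and> u < z" if "u \<in> ?L" for u
            using that xz y by (auto simp: order.order_iff_strict)
          with mem have "Max ?L < z" "x \<le> Min ?L" by blast+
          then show "Max ?L - Min ?L < Max L - Min L" using y unfolding x_def[symmetric] z_def[symmetric] by linarith
          show "?L \<subseteq> {a..<N}" using L yN by auto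
          show "card ?L = k - a" using fin xz y less.prems(3) c2 by simp
        qed
        have "finite ?B" "{a, x, y, z} \<inter> ?B = {}" using fin y ax False by auto
        note exchange = tropical_approx_exchange[OF this(1) ax y(1,2) this(2)]
        obtain h1 c1 h2 c2 h3 c3 h4 c4 h5 c5 where
          "tropical_approx (initial_sets N k) (?B \<union> {a, x}) h1 c1"
          "tropical_approx (initial_sets N k) (?B \<union> {y, z}) h2 c2"
          "tropical_approx (initial_sets N k) (?B \<union> {a, z}) h3 c3"
          "tropical_approx (initial_sets N k) (?B \<union> {x, y}) h4 c4"
          "tropical_approx (initial_sets N k) (?B \<union> {a, y}) h5 c5"
          using ex1 ex2 ex3 ex4 ex5 by (elim exE)
        from exchange[OF this] show ?thesis unfolding sets(6) by (intro exI)
      qed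
    qed
  qed
qed

section \<open>Initial minors as coordinates for totally positive matrices\<close>

lemma mem_stacked_set:
  "x \<in> stacked_set n I J \<longleftrightarrow> x < n \<and> n - 1 - x \<notin> J \<or> n \<le> x \<and> x - n \<in> I"
proof -
  have "x \<in> (\<lambda>c. n - 1 - c) ` ({..<n} - J) \<longleftrightarrow> x < n \<and> n - 1 - x \<notin> J"
  proof
    assume "x < n \<and> n - 1 - x \<notin> J"
    then show "x \<in> (\<lambda>c. n - 1 - c) ` ({..<n} - J)"
      by (intro image_eqI[of _ _ "n - 1 - x"]) auto
  qed auto
  moreover have "x \<in> (+) n ` I \<longleftrightarrow> n \<le> x \<and> x - n \<in> I"
    by (auto simp: image_iff intro: bexI[of _ "x - n"])
  ultimately show ?thesis by (auto simp: stacked_set_def)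
qed

lemma stacked_set_empty: "stacked_set n {} {} = {0..<n}"
  by (auto simp: mem_stacked_set)

abbreviation corner :: "nat \<Rightarrow> nat \<Rightarrow> nat \<Rightarrow> nat set" where
  "corner n i j \<equiv> stacked_set n {i - min i j..<Suc i} {j - min i j..<Suc j}"

lemma corner_intervals:
  assumes "i < n" "j < n"
  shows "{i - min i j..<Suc i} \<subseteq> {..<n}" "{j - min i j..<Suc j} \<subseteq> {..<n}"
    "card {i - min i j..<Suc i} = card {j - min i j..<Suc j}"
  using assms by auto

lemma initial_sets_corner:
  assumes "T \<in> initial_sets (2 * n) n"
  shows "T = {0..<n} \<or> (\<exists>i<n. \<exists>j<n. T = corner n i j)"
proof -
  obtain a b where T: "T = {0..<a} \<union> {b..<b + (n - a)}" "a \<le> b" "a \<le> n" "b + (n - a) \<le> 2 * n"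
    using assms unfolding initial_sets_def by auto
  show ?thesis
  proof (cases "a = b \<or> a = n")
    case True
    then show ?thesis using T by auto
  next
    case False
    then have lt: "a < b" "a < n" "b \<le> n + a" using T by auto
    \<comment> \<open>Row \<open>a\<close> is the first row missing from \<open>T\<close>, which
      determines \<open>j\<close>; the last row of \<open>T\<close> is \<open>n + i\<close>, which
      determines \<open>i\<close>.\<close>
    define i j where "i = b - 1 - a" and "j = n - 1 - a"
    have "x \<in> T \<longleftrightarrow> x \<in> corner n i j" for x
      unfolding mem_stacked_set T(1) using lt by (auto simp: i_def j_def min_def)
    then have "T = corner n i j" by blast
    moreover have "i < n" "j < n" using lt by (auto simp: i_def j_def)
    ultimately show ?thesis by blast
  qed
qed

lemma finite_initial_sets: "finite (initial_sets N k)"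
proof (rule finite_subset)
  show "initial_sets N k \<subseteq> Pow {..<N + k}" unfolding initial_sets_def by auto
qed simp

definition stacked_minor :: "nat \<Rightarrow> real mat \<Rightarrow> nat set \<Rightarrow> real" where
  "stacked_minor n X = set_det (stacked n (\<lambda>i j. X $$ (i, j)))"

lemma minor_eq_stacked_minor:
  assumes "X \<in> carrier_mat n n" "I \<subseteq> {1..n}" "J \<subseteq> {1..n}" "card I = card J"
  shows "minor X I J = stacked_minor n X (stacked_set n {i. Suc i \<in> I} {j. Suc j \<in> J})"
  using minor_eq_list_minor[OF assms] assms Suc_vimage_index_set
  by (simp add: stacked_minor_def set_det_stacked_set)

lemma totally_positive_iff:
  "totally_positive n X \<longleftrightarrow> X \<in> carrier_mat n n \<and>
    (\<forall>I J. I \<subseteq> {..<n} \<and> J \<subseteq> {..<n} \<and> card I = card J \<longrightarrow> stacked_minor n X (stacked_set n I J) > 0)"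
proof (intro iffI conjI allI impI)
  assume tp: "totally_positive n X"
  then show X: "X \<in> carrier_mat n n" by (simp add: totally_positive_def)
  fix I J :: "nat set" assume IJ: "I \<subseteq> {..<n} \<and> J \<subseteq> {..<n} \<and> card I = card J"
  have "{i. Suc i \<in> Suc ` K} = K" for K by auto
  moreover have "Suc ` I \<subseteq> {1..n}" "Suc ` J \<subseteq> {1..n}" "card (Suc ` I) = card (Suc ` J)"
    using IJ by (auto simp: card_image)
  ultimately show "stacked_minor n X (stacked_set n I J) > 0"
    using minor_eq_stacked_minor[OF X, of "Suc ` I" "Suc ` J"] tp unfolding totally_positive_def by metis
next
  assume *: "X \<in> carrier_mat n n \<and>
    (\<forall>I J. I \<subseteq> {..<n} \<and> J \<subseteq> {..<n} \<and> card I = card J \<longrightarrow> stacked_minor n X (stacked_set n I J) > 0)"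
  show "totally_positive n X" unfolding totally_positive_def
  proof (intro conjI allI impI)
    fix I J assume IJ: "I \<subseteq> {1..n} \<and> J \<subseteq> {1..n} \<and> card I = card J"
    have "{i. Suc i \<in> I} \<subseteq> {..<n}" "{j. Suc j \<in> J} \<subseteq> {..<n}"
      "card {i. Suc i \<in> I} = card {j. Suc j \<in> J}"
      using IJ Suc_vimage_index_set[of I n] Suc_vimage_index_set[of J n] by simp_all
    then have "stacked_minor n X (stacked_set n {i. Suc i \<in> I} {j. Suc j \<in> J}) > 0"
      using * by blast
    then show "minor X I J > 0" using minor_eq_stacked_minor[of X n I J] * IJ by simp
  qed (use * in simp)
qed

lemma three_term_stacked_minor: "three_term (stacked_minor n X)"
  unfolding three_term_def stacked_minor_def using set_det_three_term by blast

text \<open>Taking all top rows gives the empty minor. Its logarithm is 0, so the label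
  \<open>{0..<n}\<close> is left out of the free coordinates below.\<close>

lemma stacked_minor_top: "stacked_minor n X {0..<n} = 1"
proof -
  have "stacked_minor n X (stacked_set n {} {}) = 1"
    unfolding stacked_minor_def by (subst set_det_stacked_set) (auto simp: list_minor_def)
  then show ?thesis by (simp add: stacked_set_empty)
qed

text \<open>On labels in \<open>pluecker_indices\<close> this is the cyclic shift that sends
  \<open>k <= n\<close> to \<open>n + k - 1\<close> and \<open>k > n\<close> to
  \<open>k - n - 1\<close>.\<close>

definition pluecker_set :: "nat \<Rightarrow> nat set \<Rightarrow> nat set" where
  "pluecker_set n K = stacked_set n {i. Suc i \<in> pluecker_rows n K} {j. Suc j \<in> pluecker_cols n K}"

lemma pluecker_eq_stacked_minor:
  assumes "K \<in> pluecker_indices n" "X \<in> carrier_mat n n"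
  shows "pluecker n K X = stacked_minor n X (pluecker_set n K)"
  unfolding pluecker_def pluecker_set_def
  by (rule minor_eq_stacked_minor[OF assms(2) _ _ card_pluecker_rows_cols[OF assms(1)]])
    (auto simp: pluecker_rows_def pluecker_cols_def)

lemma tropical_approx_stacked:
  assumes "I \<subseteq> {..<n}" "J \<subseteq> {..<n}" "card I = card J"
  shows "\<exists>h c. tropical_approx (initial_sets (2 * n) n) (stacked_set n I J) h c"
  using tropical_approx_exists[of "stacked_set n I J" 0 "2 * n" n]
    stacked_set_subset[OF assms(1)] card_stacked_set[OF assms] by (auto simp: subset_iff)

lemma tropical_approx_pluecker:
  assumes "K \<in> pluecker_indices n"
  shows "\<exists>h c. tropical_approx (initial_sets (2 * n) n) (pluecker_set n K) h c"
proof -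
  have "pluecker_rows n K \<subseteq> {1..n}" "pluecker_cols n K \<subseteq> {1..n}"
    by (auto simp: pluecker_rows_def pluecker_cols_def)
  then show ?thesis unfolding pluecker_set_def
    using Suc_vimage_index_set card_pluecker_rows_cols[OF assms]
    by (intro tropical_approx_stacked) simp_all
qed

lemma tropical_coordinates:
  assumes "totally_positive n X"
  shows "\<exists>w\<in>supported_on (initial_sets (2 * n) n - {{0..<n}}). \<forall>T\<in>initial_sets (2 * n) n.
    stacked_minor n X T > 0 \<and> w T = ln (stacked_minor n X T)"
proof -
  have "stacked_minor n X (corner n i j) > 0" if "i < n" "j < n" for i j
    using assms corner_intervals[OF that] unfolding totally_positive_iff by blast
  then have "stacked_minor n X T > 0" if "T \<in> initial_sets (2 * n) n" for T
    using initial_sets_corner[OF that] stacked_minor_top[of n X] by auto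
  then show ?thesis
    by (intro bexI[of _ "\<lambda>T. if T \<in> initial_sets (2 * n) n - {{0..<n}} then ln (stacked_minor n X T) else 0"])
      (auto simp: supported_on_def stacked_minor_top)
qed

text \<open>The initial minors can be prescribed as \<open>exp (w T)\<close>. Every other minor is a
  subtraction-free expression in them and hence positive.\<close>

lemma tropical_realization:
  assumes w: "w \<in> supported_on (initial_sets (2 * n) n - {{0..<n}})"
  shows "\<exists>X. totally_positive n X \<and> (\<forall>T\<in>initial_sets (2 * n) n.
    stacked_minor n X T > 0 \<and> w T = ln (stacked_minor n X T))"
proof -
  obtain A where A: "\<forall>i<n. \<forall>j<n. corner_minor A i j = exp (w (corner n i j))"
    using exists_corner_minors[of "\<lambda>i j. exp (w (corner n i j))" n] by auto
  define X where "X = mat n n (\<lambda>(i, j). A i j)"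
  have "stacked_minor n X (corner n i j) = exp (w (corner n i j))" if ij: "i < n" "j < n" for i j
  proof -
    have "stacked_minor n X (corner n i j) = corner_minor (\<lambda>i j. X $$ (i, j)) i j"
      unfolding stacked_minor_def
      by (simp only: set_det_stacked_set[OF corner_intervals[OF ij]] sorted_list_of_set_range)
    also have "\<dots> = corner_minor A i j"
      by (rule list_minor_cong) (use ij in \<open>auto simp: X_def\<close>)
    finally show ?thesis using A ij by simp
  qed
  note corners = this
  have w0: "w {0..<n} = 0" using w by (simp add: supported_on_def)
  have init: "\<forall>T\<in>initial_sets (2 * n) n. stacked_minor n X T > 0 \<and> w T = ln (stacked_minor n X T)"
  proof
    fix T assume "T \<in> initial_sets (2 * n) n"
    from initial_sets_corner[OF this] show "stacked_minor n X T > 0 \<and> w T = ln (stacked_minor n X T)"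
    proof
      assume "T = {0..<n}"
      then show ?thesis using w0 by (simp add: stacked_minor_top)
    next
      assume "\<exists>i<n. \<exists>j<n. T = corner n i j"
      then obtain i j where "i < n" "j < n" "T = corner n i j" by blast
      then show ?thesis using corners by simp
    qed
  qed
  have "totally_positive n X" unfolding totally_positive_iff
  proof (intro conjI allI impI)
    fix I J :: "nat set" assume "I \<subseteq> {..<n} \<and> J \<subseteq> {..<n} \<and> card I = card J"
    then obtain h c where "tropical_approx (initial_sets (2 * n) n) (stacked_set n I J) h c"
      using tropical_approx_stacked by blast
    then show "stacked_minor n X (stacked_set n I J) > 0"
      using init three_term_stacked_minor unfolding tropical_approx_def by blast
  qed (simp add: X_def)
  with init show ?thesis by blast
qed

text \<open>This collects what the argument about ratios needs of matrices: up to bounded errors,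
  the logarithmic Pluecker vectors of totally positive matrices are the vectors
  \<open>h K w\<close>, with \<open>w\<close> ranging over a full coordinate space.\<close>

lemma tropical_model:
  "\<exists>(I :: nat set set) h c. finite I \<and> (\<forall>K\<in>pluecker_indices n. h K \<in> pl_functions) \<and>
    (\<forall>X. totally_positive n X \<longrightarrow> (\<exists>w\<in>supported_on I. \<forall>K\<in>pluecker_indices n.
      \<bar>ln (pluecker n K X) - h K w\<bar> \<le> c K)) \<and>
    (\<forall>w\<in>supported_on I. \<exists>X. totally_positive n X \<and> (\<forall>K\<in>pluecker_indices n.
      \<bar>ln (pluecker n K X) - h K w\<bar> \<le> c K))"
proof -
  let ?E = "initial_sets (2 * n) n"
  obtain h c where hc: "\<forall>K\<in>pluecker_indices n. tropical_approx ?E (pluecker_set n K) (h K) (c K)"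
    using tropical_approx_pluecker[of _ n] by metis
  have approx: "\<forall>K\<in>pluecker_indices n. \<bar>ln (pluecker n K X) - h K w\<bar> \<le> c K"
    if "totally_positive n X" "\<forall>T\<in>?E. stacked_minor n X T > 0 \<and> w T = ln (stacked_minor n X T)" for X w
  proof
    fix K assume K: "K \<in> pluecker_indices n"
    have "X \<in> carrier_mat n n" using that(1) by (simp add: totally_positive_def)
    moreover have "\<bar>ln (stacked_minor n X (pluecker_set n K)) - h K w\<bar> \<le> c K"
      using hc K that(2) three_term_stacked_minor unfolding tropical_approx_def by blast
    ultimately show "\<bar>ln (pluecker n K X) - h K w\<bar> \<le> c K"
      using K by (simp add: pluecker_eq_stacked_minor)
  qed
  show ?thesis
  proof (intro exI[of _ "?E - {{0..<n}}"] exI[of _ h] exI[of _ c] conjI allI impI ballI)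
    show "finite (?E - {{0..<n}})" by (simp add: finite_initial_sets)
    show "h K \<in> pl_functions" if "K \<in> pluecker_indices n" for K
      using hc that by (simp add: tropical_approx_def)
    show "\<exists>w\<in>supported_on (?E - {{0..<n}}). \<forall>K\<in>pluecker_indices n. \<bar>ln (pluecker n K X) - h K w\<bar> \<le> c K"
      if "totally_positive n X" for X
      using tropical_coordinates[OF that] approx[OF that] by blast
    show "\<exists>X. totally_positive n X \<and> (\<forall>K\<in>pluecker_indices n. \<bar>ln (pluecker n K X) - h K w\<bar> \<le> c K)"
      if "w \<in> supported_on (?E - {{0..<n}})" for w
      using tropical_realization[OF that] approx by blast
  qed
qed

section \<open>Bounded ratios\<close>

lemma pluecker_pos:
  assumes "totally_positive n X" "K \<in> pluecker_indices n"
  shows "pluecker n K X > 0"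
proof -
  have "pluecker_rows n K \<subseteq> {1..n}" "pluecker_cols n K \<subseteq> {1..n}"
    by (auto simp: pluecker_rows_def pluecker_cols_def)
  then show ?thesis using assms card_pluecker_rows_cols[OF assms(2)]
    unfolding totally_positive_def pluecker_def by blast
qed

lemma ratio_eq_exp:
  assumes "totally_positive n X"
  shows "ratio n \<alpha> X = exp (\<Sum>K\<in>pluecker_indices n. real_of_int (\<alpha> K) * ln (pluecker n K X))"
proof -
  have "pluecker n K X powi \<alpha> K = exp (real_of_int (\<alpha> K) * ln (pluecker n K X))" if "K \<in> pluecker_indices n" for K
  proof -
    have p: "pluecker n K X > 0" using pluecker_pos[OF assms that] .
    have "pluecker n K X powi \<alpha> K = pluecker n K X powr real_of_int (\<alpha> K)"
      using p by (simp add: powr_real_of_int')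
    then show ?thesis using p by (simp add: powr_def)
  qed
  then show ?thesis unfolding ratio_def by (simp add: exp_sum finite_pluecker_indices)
qed

text \<open>The logarithm of the ratio is within a fixed \<open>M\<close> of the piecewise linear
  \<open>?L\<close>. A point with \<open>?L > 0\<close> can be scaled until the ratio exceeds any
  bound. If \<open>?L <= 0\<close> on all generators, the same holds on every cone of the fan, and
  \<open>exp M\<close> is a bound.\<close>

lemma bounded_ratio_iff:
  fixes h :: "nat set \<Rightarrow> ('i \<Rightarrow> real) \<Rightarrow> real"
  assumes fan: "fan (supported_on I) \<F>"
    and lin: "\<And>K G. K \<in> pluecker_indices n \<Longrightarrow> G \<in> \<F> \<Longrightarrow> linear_on_cone (h K) G"
    and pl: "\<And>K. K \<in> pluecker_indices n \<Longrightarrow> h K \<in> pl_functions"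
    and up: "\<And>X. totally_positive n X \<Longrightarrow> \<exists>w\<in>supported_on I. \<forall>K\<in>pluecker_indices n.
      \<bar>ln (pluecker n K X) - h K w\<bar> \<le> c K"
    and down: "\<And>w. w \<in> supported_on I \<Longrightarrow> \<exists>X. totally_positive n X \<and> (\<forall>K\<in>pluecker_indices n.
      \<bar>ln (pluecker n K X) - h K w\<bar> \<le> c K)"
    and \<alpha>: "\<alpha> \<in> ratio_exponents n"
  shows "bounded_ratio n \<alpha> \<longleftrightarrow>
    (\<forall>g\<in>\<Union>\<F>. (\<Sum>K\<in>pluecker_indices n. real_of_int (\<alpha> K) * h K g) \<le> 0)"
proof -
  let ?P = "pluecker_indices n"
  let ?L = "\<lambda>w. \<Sum>K\<in>?P. real_of_int (\<alpha> K) * h K w"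
  let ?R = "\<lambda>X. \<Sum>K\<in>?P. real_of_int (\<alpha> K) * ln (pluecker n K X)"
  define M where "M = (\<Sum>K\<in>?P. \<bar>real_of_int (\<alpha> K)\<bar> * c K)"
  have close: "\<bar>?R X - ?L w\<bar> \<le> M" if "\<forall>K\<in>?P. \<bar>ln (pluecker n K X) - h K w\<bar> \<le> c K" for X w
  proof -
    have "?R X - ?L w = (\<Sum>K\<in>?P. real_of_int (\<alpha> K) * (ln (pluecker n K X) - h K w))"
      by (simp add: sum_subtractf right_diff_distrib)
    also have "\<bar>\<dots>\<bar> \<le> (\<Sum>K\<in>?P. \<bar>real_of_int (\<alpha> K) * (ln (pluecker n K X) - h K w)\<bar>)"
      by (rule sum_abs)
    also have "\<dots> \<le> M" unfolding M_def abs_mult using that by (intro sum_mono mult_left_mono) auto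
    finally show ?thesis .
  qed
  show ?thesis
  proof
    assume "bounded_ratio n \<alpha>"
    then obtain C where C: "\<And>X. totally_positive n X \<Longrightarrow> ratio n \<alpha> X \<le> C"
      unfolding bounded_ratio_def by auto
    show "\<forall>g\<in>\<Union>\<F>. ?L g \<le> 0"
    proof (intro ballI, rule ccontr)
      fix g assume "g \<in> \<Union>\<F>" and "\<not> ?L g \<le> 0"
      then have pos: "?L g > 0" by simp
      obtain G where "G \<in> \<F>" "g \<in> convex_cone G" using \<open>g \<in> \<Union>\<F>\<close> convex_cone.gen by blast
      then have g: "g \<in> supported_on I" using fan unfolding fan_def by blast
      \<comment> \<open>The scaling makes \<open>?L\<close> large enough to beat both
        \<open>ln C\<close> and the approximation error \<open>M\<close>.\<close>
      define t where "t = (\<bar>ln C\<bar> + \<bar>M\<bar> + 1) / ?L g"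
      have t: "t \<ge> 0" using pos by (simp add: t_def)
      have "(\<lambda>i. t * g i) \<in> supported_on I" using g by (simp add: supported_on_def)
      from down[OF this] obtain X where X: "totally_positive n X"
        "\<forall>K\<in>?P. \<bar>ln (pluecker n K X) - h K (\<lambda>i. t * g i)\<bar> \<le> c K" by auto
      have "?L (\<lambda>i. t * g i) = t * ?L g"
        using pl_functions_scale[OF pl t] by (simp add: sum_distrib_left mult.left_commute)
      also have "\<dots> = \<bar>ln C\<bar> + \<bar>M\<bar> + 1" using pos by (simp add: t_def)
      finally have "?R X \<ge> \<bar>ln C\<bar> + 1" using close[OF X(2)] by linarith
      moreover have "exp (?R X) \<le> C" using C[OF X(1)] unfolding ratio_eq_exp[OF X(1)] .
      then have "?R X \<le> ln C" by (metis exp_gt_zero ln_exp ln_le_cancel_iff order_less_le_trans)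
      ultimately show False by linarith
    qed
  next
    assume neg: "\<forall>g\<in>\<Union>\<F>. ?L g \<le> 0"
    have "?L w \<le> 0" if w: "w \<in> supported_on I" for w
    proof -
      obtain G where G: "G \<in> \<F>" "w \<in> convex_cone G" using fan w unfolding fan_def by blast
      have "linear_on_cone (\<lambda>w. - ?L w) G"
        by (intro linear_on_cone_uminus linear_on_cone_sum lin) (use G in auto)
      then have "- ?L w \<ge> 0" by (rule linear_on_cone_nonneg[OF _ _ G(2)]) (use neg G in auto)
      then show ?thesis by simp
    qed
    then have "ratio n \<alpha> X \<le> exp M" if "totally_positive n X" for X
      using up[OF that] close[of X] unfolding ratio_eq_exp[OF that] by fastforce
    then show "bounded_ratio n \<alpha>" using \<alpha> unfolding bounded_ratio_def by blast
  qed
qed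

lemma V_eq_supported_on: "V n = supported_on (pluecker_indices n)"
  by (simp add: V_def supported_on_def)

theorem theorem3p4:
  fixes n :: nat
  assumes "n \<ge> 1"
  shows "polyhedral_cone n (bounded_ratio_cone n)"
proof -
  let ?P = "pluecker_indices n"
  obtain I :: "nat set set" and h c where model: "finite I" "\<forall>K\<in>?P. h K \<in> pl_functions"
    "\<forall>X. totally_positive n X \<longrightarrow> (\<exists>w\<in>supported_on I. \<forall>K\<in>?P. \<bar>ln (pluecker n K X) - h K w\<bar> \<le> c K)"
    "\<forall>w\<in>supported_on I. \<exists>X. totally_positive n X \<and> (\<forall>K\<in>?P. \<bar>ln (pluecker n K X) - h K w\<bar> \<le> c K)"
    using tropical_model[of n] by auto
  obtain \<F> where fan: "fan (supported_on I) \<F>" "\<forall>K\<in>?P. \<forall>G\<in>\<F>. linear_on_cone (h K) G"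
    using fan_supported_on[OF model(1) finite_pluecker_indices[of n], of h] model(2) by auto
  \<comment> \<open>Coefficients are cut off outside the Pluecker labels to lie in
    \<open>V n\<close>, as \<open>polyhedral_cone\<close> demands.\<close>
  define ineq :: "(nat set \<Rightarrow> real) \<Rightarrow> nat set \<Rightarrow> real" where
    "ineq a = (\<lambda>K. if K \<in> ?P then a K else 0)" for a
  \<comment> \<open>The constant vectors 1 and -1 together encode the equation that the exponents
    sum to 0.\<close>
  define A where "A = (\<lambda>g. ineq (\<lambda>K. - h K g)) ` \<Union>\<F> \<union> {ineq (\<lambda>_. 1), ineq (\<lambda>_. - 1)}"
  have ineq: "(\<Sum>K\<in>?P. ineq a K * v K) = (\<Sum>K\<in>?P. v K * a K)" for a v
    by (simp add: ineq_def mult.commute)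
  have finA: "finite A" using fan(1) by (auto simp: A_def fan_def)
  have AV: "A \<subseteq> V n" by (auto simp: A_def V_def ineq_def)
  have intA: "a K \<in> \<int>" if "a \<in> A" for a K
    using that fan(2) by (auto simp: A_def ineq_def linear_on_cone_def)
  have sol: "v \<in> solution_set n A \<longleftrightarrow> v \<in> V n \<and> (\<Sum>K\<in>?P. v K) = 0 \<and>
      (\<forall>g\<in>\<Union>\<F>. (\<Sum>K\<in>?P. v K * h K g) \<le> 0)" for v
    unfolding solution_set_def A_def by (auto simp: ineq sum_negf)
  have bounded: "bounded_ratio n \<alpha> \<longleftrightarrow> (\<lambda>K. real_of_int (\<alpha> K)) \<in> solution_set n A" for \<alpha>
  proof (cases "\<alpha> \<in> ratio_exponents n")
    case True
    have "bounded_ratio n \<alpha> \<longleftrightarrow> (\<forall>g\<in>\<Union>\<F>. (\<Sum>K\<in>?P. real_of_int (\<alpha> K) * h K g) \<le> 0)"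
      using model fan by (intro bounded_ratio_iff[OF fan(1) _ _ _ _ True, where c = c]) auto
    then show ?thesis using True unfolding sol
      by (auto simp: ratio_exponents_def V_def simp flip: of_int_sum)
  next
    case False
    then show ?thesis unfolding sol bounded_ratio_def
      by (auto simp: ratio_exponents_def V_def simp flip: of_int_sum)
  qed
  obtain G where G: "finite G" "\<forall>g\<in>G. \<forall>K. g K \<in> \<int>" "convex_cone G = solution_set n A"
    using integer_cone_finitely_generated[OF finite_pluecker_indices[of n] finA] intA
    unfolding solution_set_def V_eq_supported_on by blast
  let ?B = "{(\<lambda>K. real_of_int (\<alpha> K)) | \<alpha>. bounded_ratio n \<alpha>}"
  have "G \<subseteq> ?B"
  proof
    fix g assume g: "g \<in> G"
    \<comment> \<open>An integral generator is itself an exponent vector, recovered by taking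
      floors; so the generators of the solution set are bounded ratios.\<close>
    have eq: "g = (\<lambda>K. real_of_int \<lfloor>g K\<rfloor>)" using G(2) g by (simp add: fun_eq_iff)
    have "g \<in> solution_set n A" using G(3) convex_cone.gen[OF g] by simp
    then have "bounded_ratio n (\<lambda>K. \<lfloor>g K\<rfloor>)" unfolding bounded using eq by simp
    with eq show "g \<in> ?B" by (intro CollectI exI[of _ "\<lambda>K. \<lfloor>g K\<rfloor>"] conjI)
  qed
  then have "solution_set n A \<subseteq> convex_cone ?B"
    unfolding G(3)[symmetric] by (intro convex_cone_subset) (auto intro: convex_cone.gen)
  moreover have "convex_cone ?B \<subseteq> solution_set n A"
    unfolding G(3)[symmetric] by (intro convex_cone_subset) (auto simp: G(3) bounded)
  ultimately have "bounded_ratio_cone n = solution_set n A"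
    unfolding bounded_ratio_cone_def cone_generated_by_eq by blast
  then show ?thesis unfolding polyhedral_cone_def using finA AV by blast
qed

end
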